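(* Let $\Lambda \curvearrowright I$ be a free action of the countable infinite group $\Lambda$ on the countable set $I$, let $\delta > 0$ and let $F : I \to (0,1)$ be a function such that $\delta \leq F(i) \leq 1-\delta$ for all $i \in I$ and $\sum_{i \in I} (F(g \cdot i) - F(i))^2 < \infty$ for all $g \in \Lambda$. Let $(X,\mu) = \prod_{i \in I} (\{0,1\},\mu_i)$ with $\mu_i(0) = F(i)$, let $\Lambda \curvearrowright (X,\mu)$ be the associated (nonsingular) Bernoulli action $(g\cdot x)_i = x_{g^{-1}\cdot i}$, and let $c : \Lambda \to \ell^2(I)$ be the 1-cocycle $c_g(i) = F(i) - F(g^{-1} \cdot i)$. 1. If $\sum_{g \in \Lambda} \exp(-\kappa \|c_g\|_2^2) = +\infty$ for some $\kappa > \delta^{-2} + \delta^{-1}(1-\delta)^{-2}$, then the action $\Lambda \curvearrowright (X,\mu)$ is conservative. 2. If $\sum_{g \in \Lambda} \exp(- \frac{1}{2} \|c_g\|_2^2) < +\infty$, then the action $\Lambda \curvearrowright (X,\mu)$ is dissipative. In particular, if $1/3 \leq F(i) \leq 2/3$ for all $i \in I$ and if $\sum_{g \in \Lambda} \exp(-16 \|c_g\|_2^2) = +\infty$, then the action $\Lambda \curvearrowright (X,\mu)$ is conservative.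
   Context: An action of $\Lambda$ on a set $I$ is free if $g \cdot i \neq i$ for all $g \neq e$ and $i \in I$. A nonsingular action $\Lambda \curvearrowright (X,\mu)$ (one preserving the measure class of $\mu$) is dissipative if there exists a Borel set $\mathcal{U} \subset X$ such that all $g \cdot \mathcal{U}$, $g \in \Lambda$, are disjoint and $\bigcup_{g \in \Lambda} g \cdot \mathcal{U} = X$ up to measure zero. It is conservative if for every non-null Borel set $\mathcal{U} \subset X$ there exists $g \in \Lambda \setminus \{e\}$ such that $g \cdot \mathcal{U} \cap \mathcal{U}$ is non-null. Under the stated hypotheses on $F$, the Bernoulli action is nonsingular by Kakutani's theorem. *)

theory Defs
  imports "HOL-Probability.Probability" "HOL-Algebra.Group_Action"
begin

definition free_action :: "('g, 'm) monoid_scheme \<Rightarrow> 'i set \<Rightarrow> ('g \<Rightarrow> 'i \<Rightarrow> 'i) \<Rightarrow> bool" where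
  "free_action G I \<phi> \<longleftrightarrow> group_action G I \<phi> \<and>
     (\<forall>g\<in>carrier G. g \<noteq> \<one>\<^bsub>G\<^esub> \<longrightarrow> (\<forall>i\<in>I. \<phi> g i \<noteq> i))"

text \<open>An action by measurable maps is nonsingular if every push-forward of the measure has the
  same null sets as the measure itself. Dissipativity and conservativity are notions for
  nonsingular actions only, so both definitions below include nonsingularity.\<close>

definition nonsingular_action ::
    "('g, 'm) monoid_scheme \<Rightarrow> 'x measure \<Rightarrow> ('g \<Rightarrow> 'x \<Rightarrow> 'x) \<Rightarrow> bool" where
  "nonsingular_action G M a \<longleftrightarrow> group_action G (space M) a \<and>
     (\<forall>g\<in>carrier G. a g \<in> measurable M M \<and>
        absolutely_continuous M (distr M M (a g)) \<and>
        absolutely_continuous (distr M M (a g)) M)"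

definition dissipative_action ::
    "('g, 'm) monoid_scheme \<Rightarrow> 'x measure \<Rightarrow> ('g \<Rightarrow> 'x \<Rightarrow> 'x) \<Rightarrow> bool" where
  "dissipative_action G M a \<longleftrightarrow> nonsingular_action G M a \<and>
     (\<exists>U\<in>sets M. disjoint_family_on (\<lambda>g. a g ` U) (carrier G) \<and>
        space M - (\<Union>g\<in>carrier G. a g ` U) \<in> null_sets M)"

definition conservative_action ::
    "('g, 'm) monoid_scheme \<Rightarrow> 'x measure \<Rightarrow> ('g \<Rightarrow> 'x \<Rightarrow> 'x) \<Rightarrow> bool" where
  "conservative_action G M a \<longleftrightarrow> nonsingular_action G M a \<and>
     (\<forall>U\<in>sets M. emeasure M U > 0 \<longrightarrow>
        (\<exists>g\<in>carrier G - {\<one>\<^bsub>G\<^esub>}. emeasure M (a g ` U \<inter> U) > 0))"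

text \<open>The two-point space \<open>{0,1}\<close> is rendered as \<open>bool\<close>, with \<open>False\<close> for \<open>0\<close> and \<open>True\<close> for
  \<open>1\<close>. As \<open>bernoulli_pmf p\<close> gives mass \<open>p\<close> to \<open>True\<close>, the point \<open>0\<close> has mass \<open>F i\<close>.\<close>

definition bernoulli_space :: "'i set \<Rightarrow> ('i \<Rightarrow> real) \<Rightarrow> ('i \<Rightarrow> bool) measure" where
  "bernoulli_space I F = PiM I (\<lambda>i. measure_pmf (bernoulli_pmf (1 - F i)))"

lemma pmf_bernoulli_space_factor:
  assumes "F i \<in> {0<..<1::real}"
  shows "pmf (bernoulli_pmf (1 - F i)) False = F i"
  using assms by simp

text \<open>Points of the product and elements of \<open>Bij\<close> are extensional, hence the two restrictions.\<close>

definition bernoulli_action ::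
    "('g, 'm) monoid_scheme \<Rightarrow> 'i set \<Rightarrow> ('g \<Rightarrow> 'i \<Rightarrow> 'i) \<Rightarrow> 'g \<Rightarrow> ('i \<Rightarrow> bool) \<Rightarrow> ('i \<Rightarrow> bool)" where
  "bernoulli_action G I \<phi> g = (\<lambda>x\<in>(I \<rightarrow>\<^sub>E UNIV). \<lambda>i\<in>I. x (\<phi> (inv\<^bsub>G\<^esub> g) i))"

definition bernoulli_cocycle ::
    "('g, 'm) monoid_scheme \<Rightarrow> ('g \<Rightarrow> 'i \<Rightarrow> 'i) \<Rightarrow> ('i \<Rightarrow> real) \<Rightarrow> 'g \<Rightarrow> 'i \<Rightarrow> real" where
  "bernoulli_cocycle G \<phi> F g i = F i - F (\<phi> (inv\<^bsub>G\<^esub> g) i)"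

text \<open>Only meaningful for square-summable functions: \<open>infsum\<close> is \<open>0\<close> on non-summable ones.\<close>

definition ell2_norm :: "'i set \<Rightarrow> ('i \<Rightarrow> real) \<Rightarrow> real" where
  "ell2_norm I f = sqrt (\<Sum>\<^sub>\<infinity>i\<in>I. (f i)\<^sup>2)"

lemma bernoulli_cocycle_square_summable:
  assumes "group G" and "g \<in> carrier G"
    and "\<And>g. g \<in> carrier G \<Longrightarrow> (\<lambda>i. (F (\<phi> g i) - F i)\<^sup>2) summable_on I"
  shows "(\<lambda>i. (bernoulli_cocycle G \<phi> F g i)\<^sup>2) summable_on I"
  unfolding bernoulli_cocycle_def
  using assms(3)[OF group.inv_closed[OF assms(1,2)]] by (simp add: power2_commute)

end

theory Submission
  imports Defs
begin

text \<open>Write \<open>\<mu>\<close> for the Bernoulli measure with parameter \<open>F\<close>. The push-forward of \<open>\<mu>\<close> under \<open>g\<close> is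
  the Bernoulli measure \<open>\<mu>\<^sub>g\<close> with parameter \<open>i \<mapsto> F (g\<inverse> i)\<close>, so everything rests on comparing two
  product measures whose parameters differ by the square-summable function \<open>c\<^sub>g\<close>. Two estimates
  are used, each a product over the coordinates of an elementary inequality for two-point laws.

  The first estimate is \<open>\<mu>(U)\<^sup>2 \<le> \<mu>\<^sub>g(U) exp (\<parallel>c\<^sub>g\<parallel>\<^sup>2 / \<delta>\<^sup>2)\<close> for every measurable \<open>U\<close>
  (\<open>bernoulli_measure_square_le\<close>). For cylinder sets it is the Cauchy-Schwarz inequality, and it
  extends to all measurable sets by approximation. It shows that the action is nonsingular. It
  also gives conservativity (\<open>conservative_actionI\<close>): if a set \<open>U\<close> of positive measure were almost
  disjoint from all its other translates, then the measures \<open>\<mu>\<^sub>g(U)\<close> of the translates would have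
  sum at most \<open>1\<close>, and the series of the \<open>exp (- \<parallel>c\<^sub>g\<parallel>\<^sup>2 / \<delta>\<^sup>2)\<close> would converge.

  The second estimate bounds the Hellinger affinity: if \<open>w\<^sub>g\<close> is the density of \<open>\<mu>\<^sub>g\<close> with respect
  to \<open>\<mu>\<close>, then \<open>\<integral> \<surd>w\<^sub>g d\<mu> \<le> exp (- \<parallel>c\<^sub>g\<parallel>\<^sup>2 / 2)\<close> (\<open>bernoulli_affinity_le\<close>). If these bounds are
  summable, then \<open>f = \<Sum>\<^sub>g \<surd>w\<^sub>g\<close> is finite almost everywhere, and a Borel-Cantelli argument shows
  that almost every orbit meets each set \<open>{f \<le> k}\<close> only finitely often
  (\<open>dissipative_action_of_summable_affinities\<close>). Hence \<open>f\<close>, rounded to integers, attains a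
  minimum on almost every orbit. Ties are broken by an injective function with values in
  \<open>[0, 1)\<close>. Since almost every point has trivial stabiliser (\<open>AE_bernoulli_action_not_fixed\<close>, a
  consequence of the freeness of the action on the index set), the minimum is then unique, and
  the minimal points form a fundamental domain (\<open>dissipative_actionI\<close>).\<close>

section \<open>Two-point distributions\<close>

text \<open>The left-hand side is the second moment of the density of the law \<open>(a, 1 - a)\<close> with respect to
  \<open>(b, 1 - b)\<close>; it equals \<open>1 + (a - b)\<^sup>2 / (b (1 - b))\<close>, and \<open>b (1 - b) \<ge> \<delta>\<^sup>2\<close>.\<close>

lemma two_point_chi_square_le:
  fixes a b \<delta> :: real
  assumes "0 < \<delta>" "\<delta> \<le> a" "a \<le> 1 - \<delta>" "\<delta> \<le> b" "b \<le> 1 - \<delta>"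
  shows "a\<^sup>2 / b + (1 - a)\<^sup>2 / (1 - b) \<le> exp ((a - b)\<^sup>2 / \<delta>\<^sup>2)"
proof -
  have b: "0 < b" "0 < 1 - b"
    using assms by auto
  have "\<delta>\<^sup>2 \<le> b * (1 - b)"
    unfolding power2_eq_square using assms by (intro mult_mono) auto
  have "a\<^sup>2 / b + (1 - a)\<^sup>2 / (1 - b) = 1 + (a - b)\<^sup>2 / (b * (1 - b))"
    using b by (simp add: field_simps power2_eq_square)
  also have "\<dots> \<le> 1 + (a - b)\<^sup>2 / \<delta>\<^sup>2"
    using b \<open>0 < \<delta>\<close> \<open>\<delta>\<^sup>2 \<le> b * (1 - b)\<close> by (intro add_left_mono divide_left_mono) auto
  also have "\<dots> \<le> exp ((a - b)\<^sup>2 / \<delta>\<^sup>2)"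
    by (rule exp_ge_add_one_self)
  finally show ?thesis .
qed

text \<open>The left-hand side is the inner product \<open>r\<close> of the unit vectors \<open>(\<surd>a, \<surd>(1 - a))\<close> and
  \<open>(\<surd>b, \<surd>(1 - b))\<close>. By Lagrange's identity \<open>1 - r\<^sup>2\<close> is the square of their determinant, and
  the determinant divides \<open>a - b\<close> with a cofactor that is itself an inner product of unit
  vectors. Hence \<open>(a - b)\<^sup>2 \<le> 1 - r\<^sup>2 \<le> 2 (1 - r)\<close>.\<close>

lemma two_point_affinity_le:
  fixes a b :: real
  assumes "0 \<le> a" "a \<le> 1" "0 \<le> b" "b \<le> 1"
  shows "sqrt (a * b) + sqrt ((1 - a) * (1 - b)) \<le> exp (- (a - b)\<^sup>2 / 2)"
proof -
  define u v p q where "u = sqrt a" and "v = sqrt b" and "p = sqrt (1 - a)" and "q = sqrt (1 - b)"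
  have sq: "u\<^sup>2 = a" "v\<^sup>2 = b" "p\<^sup>2 = 1 - a" "q\<^sup>2 = 1 - b"
    using assms by (simp_all add: u_def v_def p_def q_def)
  define r where "r = u * v + p * q"
  have r: "r\<^sup>2 + (u * q - p * v)\<^sup>2 = 1" "(u * q + p * v)\<^sup>2 + (u * v - p * q)\<^sup>2 = 1"
  proof -
    have "r\<^sup>2 + (u * q - p * v)\<^sup>2 = (u\<^sup>2 + p\<^sup>2) * (v\<^sup>2 + q\<^sup>2)"
      "(u * q + p * v)\<^sup>2 + (u * v - p * q)\<^sup>2 = (u\<^sup>2 + p\<^sup>2) * (v\<^sup>2 + q\<^sup>2)"
      by (simp_all add: r_def power2_eq_square algebra_simps)
    then show "r\<^sup>2 + (u * q - p * v)\<^sup>2 = 1" "(u * q + p * v)\<^sup>2 + (u * v - p * q)\<^sup>2 = 1"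
      by (simp_all add: sq)
  qed
  \<comment> \<open>Both terms are homogenised with \<open>u\<^sup>2 + p\<^sup>2 = v\<^sup>2 + q\<^sup>2 = 1\<close>, so that the difference factorises.\<close>
  have "a - b = u\<^sup>2 * (v\<^sup>2 + q\<^sup>2) - v\<^sup>2 * (u\<^sup>2 + p\<^sup>2)"
    by (simp add: sq)
  also have "\<dots> = (u * q - p * v) * (u * q + p * v)"
    by (simp add: power2_eq_square algebra_simps)
  finally have "(a - b)\<^sup>2 = (u * q - p * v)\<^sup>2 * (u * q + p * v)\<^sup>2"
    by (simp add: power_mult_distrib)
  also have "\<dots> \<le> (u * q - p * v)\<^sup>2"
  proof (rule mult_right_le_one_le)
    show "(u * q + p * v)\<^sup>2 \<le> 1"
      using r(2) zero_le_power2[of "u * v - p * q"] by linarith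
  qed auto
  also have "\<dots> = 1 - r\<^sup>2"
    using r(1) by simp
  also have "\<dots> \<le> 2 * (1 - r)"
    using zero_le_power2[of "1 - r"] by (simp add: power2_eq_square algebra_simps)
  finally have "r \<le> 1 + (- (a - b)\<^sup>2 / 2)"
    by simp
  also have "\<dots> \<le> exp (- (a - b)\<^sup>2 / 2)"
    by (rule exp_ge_add_one_self)
  finally show ?thesis
    by (simp add: r_def u_def v_def p_def q_def real_sqrt_mult)
qed

section \<open>Cylinder sets\<close>

definition cylinder :: "'i set \<Rightarrow> 'i set \<Rightarrow> ('i \<Rightarrow> bool) set \<Rightarrow> ('i \<Rightarrow> bool) set" where
  "cylinder I J S = {x \<in> I \<rightarrow>\<^sub>E UNIV. restrict x J \<in> S}"

lemma space_bernoulli_space [simp]: "space (bernoulli_space I F) = I \<rightarrow>\<^sub>E UNIV"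
  by (simp add: bernoulli_space_def space_PiM)

lemma sets_bernoulli_space_cong: "sets (bernoulli_space I F) = sets (bernoulli_space I F')"
  unfolding bernoulli_space_def by (rule sets_PiM_cong) auto

lemma prob_space_bernoulli_space: "prob_space (bernoulli_space I F)"
  unfolding bernoulli_space_def by (intro prob_space_PiM prob_space_measure_pmf)

lemma cylinder_singleton:
  assumes "s \<in> J \<rightarrow>\<^sub>E UNIV"
  shows "cylinder I J {s} = {x \<in> I \<rightarrow>\<^sub>E UNIV. \<forall>j\<in>J. x j \<in> {s j}}"
proof -
  have "restrict x J = s \<longleftrightarrow> (\<forall>j\<in>J. x j = s j)" for x
  proof
    assume "\<forall>j\<in>J. x j = s j"
    then show "restrict x J = s"
      using assms by (intro extensionalityI[of _ J]) (auto simp: PiE_def)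
  qed auto
  then show ?thesis
    by (simp add: cylinder_def)
qed

lemma measurable_coordinate:
  assumes "i \<in> I"
  shows "(\<lambda>x. x i) \<in> measurable (bernoulli_space I F) (count_space UNIV)"
  using measurable_component_singleton[OF assms, of "\<lambda>i. measure_pmf (bernoulli_pmf (1 - F i))"]
  unfolding bernoulli_space_def by (simp cong: measurable_cong_sets)

lemma measure_cylinder_singleton:
  assumes "finite J" "J \<subseteq> I" "s \<in> J \<rightarrow>\<^sub>E UNIV"
  shows "cylinder I J {s} \<in> sets (bernoulli_space I F)"
    and "measure (bernoulli_space I F) (cylinder I J {s})
      = (\<Prod>j\<in>J. pmf (bernoulli_pmf (1 - F j)) (s j))"
proof -
  interpret product_prob_space "\<lambda>i. measure_pmf (bernoulli_pmf (1 - F i))" I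
    by unfold_locales
  have "emeasure (bernoulli_space I F) (cylinder I J {s})
      = (\<Prod>j\<in>J. emeasure (measure_pmf (bernoulli_pmf (1 - F j))) {s j})"
    using emeasure_PiM_Collect[OF assms(2,1), of "\<lambda>j. {s j}"]
    by (simp add: cylinder_singleton[OF assms(3)] bernoulli_space_def space_PiM)
  then show "measure (bernoulli_space I F) (cylinder I J {s})
      = (\<Prod>j\<in>J. pmf (bernoulli_pmf (1 - F j)) (s j))"
    by (simp add: emeasure_pmf_single prod_ennreal measure_def prod_nonneg)
  have "cylinder I J {s} = {x \<in> space (bernoulli_space I F). \<forall>j\<in>J. x j = s j}"
    by (simp add: cylinder_singleton[OF assms(3)])
  also have "\<dots> \<in> sets (bernoulli_space I F)"
  proof (rule sets.sets_Collect_finite_All[OF _ assms(1)])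
    fix j assume "j \<in> J"
    then have "(\<lambda>x. x j) \<in> measurable (bernoulli_space I F) (count_space UNIV)"
      using assms(2) by (intro measurable_coordinate) auto
    then have "(\<lambda>x. x j) -` {s j} \<inter> space (bernoulli_space I F) \<in> sets (bernoulli_space I F)"
      by (rule measurable_sets) simp
    then show "{x \<in> space (bernoulli_space I F). x j = s j} \<in> sets (bernoulli_space I F)"
      by (simp only: vimage_def Collect_conj_eq[symmetric] Int_def mem_Collect_eq singleton_iff conj_commute)
  qed
  finally show "cylinder I J {s} \<in> sets (bernoulli_space I F)" .
qed

lemma measure_cylinder:
  assumes "finite J" "J \<subseteq> I" "S \<subseteq> J \<rightarrow>\<^sub>E UNIV"
  shows "cylinder I J S \<in> sets (bernoulli_space I F)"
    and "measure (bernoulli_space I F) (cylinder I J S)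
      = (\<Sum>s\<in>S. \<Prod>j\<in>J. pmf (bernoulli_pmf (1 - F j)) (s j))"
proof -
  interpret prob_space "bernoulli_space I F"
    by (rule prob_space_bernoulli_space)
  have fin: "finite S"
    using finite_subset[OF assms(3) finite_PiE[OF assms(1)]] by simp
  have eq: "cylinder I J S = (\<Union>s\<in>S. cylinder I J {s})"
    by (auto simp: cylinder_def)
  have sets: "cylinder I J {s} \<in> sets (bernoulli_space I F)" if "s \<in> S" for s
    using that assms by (intro measure_cylinder_singleton) auto
  show "cylinder I J S \<in> sets (bernoulli_space I F)"
    unfolding eq using fin sets by auto
  have "measure (bernoulli_space I F) (cylinder I J S)
      = (\<Sum>s\<in>S. measure (bernoulli_space I F) (cylinder I J {s}))"
    unfolding eq using fin sets
    by (intro finite_measure_finite_Union) (auto simp: disjoint_family_on_def cylinder_def)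
  also have "\<dots> = (\<Sum>s\<in>S. \<Prod>j\<in>J. pmf (bernoulli_pmf (1 - F j)) (s j))"
    using assms by (intro sum.cong refl measure_cylinder_singleton) auto
  finally show "measure (bernoulli_space I F) (cylinder I J S)
      = (\<Sum>s\<in>S. \<Prod>j\<in>J. pmf (bernoulli_pmf (1 - F j)) (s j))" .
qed

text \<open>Sums over all patterns on a finite set of coordinates factorise; this turns each estimate for
  a single coordinate into one for cylinders.\<close>

lemma sum_PiE_prod_bool:
  fixes f :: "'i \<Rightarrow> bool \<Rightarrow> real"
  assumes "finite J"
  shows "(\<Sum>s\<in>J \<rightarrow>\<^sub>E UNIV. \<Prod>j\<in>J. f j (s j)) = (\<Prod>j\<in>J. f j False + f j True)"
proof -
  have "(\<Prod>j\<in>J. \<Sum>b\<in>UNIV. f j b) = (\<Sum>s\<in>J \<rightarrow>\<^sub>E UNIV. \<Prod>j\<in>J. f j (s j))"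
    by (rule prod_sum_PiE) (use assms in auto)
  then show ?thesis
    by (simp add: UNIV_bool)
qed

lemma cylinder_algebra:
  "algebra (I \<rightarrow>\<^sub>E UNIV) {cylinder I J S |J S. finite J \<and> J \<subseteq> I \<and> S \<subseteq> J \<rightarrow>\<^sub>E UNIV}"
  (is "algebra ?\<Omega> ?A")
  unfolding algebra_iff_Un
proof (intro conjI ballI)
  show "?A \<subseteq> Pow ?\<Omega>"
    by (auto simp: cylinder_def)
  have "{} = cylinder I {} {}"
    by (simp add: cylinder_def)
  then show "{} \<in> ?A"
    by blast
  fix U assume "U \<in> ?A"
  then obtain J S where U: "U = cylinder I J S" "finite J" "J \<subseteq> I" "S \<subseteq> J \<rightarrow>\<^sub>E UNIV"
    by blast
  have "?\<Omega> - U = cylinder I J ((J \<rightarrow>\<^sub>E UNIV) - S)"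
    using U by (auto simp: cylinder_def)
  then show "?\<Omega> - U \<in> ?A"
    using U by blast
  fix V assume "V \<in> ?A"
  then obtain K R where V: "V = cylinder I K R" "finite K" "K \<subseteq> I" "R \<subseteq> K \<rightarrow>\<^sub>E UNIV"
    by blast
  have "U \<union> V = cylinder I (J \<union> K)
      {s \<in> J \<union> K \<rightarrow>\<^sub>E UNIV. restrict s J \<in> S \<or> restrict s K \<in> R}"
    unfolding U V cylinder_def by (auto simp: restrict_restrict Int_absorb1 Int_absorb2)
  then show "U \<union> V \<in> ?A"
    using U V by (intro CollectI exI[of _ "J \<union> K"] exI[of _ "{s \<in> J \<union> K \<rightarrow>\<^sub>E UNIV. restrict s J \<in> S \<or> restrict s K \<in> R}"]) auto
qed

lemma sets_bernoulli_space_eq_sigma_sets: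
  "sets (bernoulli_space I F) = sigma_sets (I \<rightarrow>\<^sub>E UNIV)
     {cylinder I J S |J S. finite J \<and> J \<subseteq> I \<and> S \<subseteq> J \<rightarrow>\<^sub>E UNIV}" (is "_ = sigma_sets _ ?A")
proof
  have "?A \<subseteq> sets (bernoulli_space I F)"
    by (auto intro: measure_cylinder(1))
  then show "sigma_sets (I \<rightarrow>\<^sub>E UNIV) ?A \<subseteq> sets (bernoulli_space I F)"
    using sets.sigma_sets_subset[of ?A "bernoulli_space I F"] by simp
  have single: "{f \<in> I \<rightarrow>\<^sub>E UNIV. f i \<in> B} \<in> ?A" if "i \<in> I" for i and B :: "bool set"
  proof -
    have "{f \<in> I \<rightarrow>\<^sub>E UNIV. f i \<in> B} = cylinder I {i} {s \<in> {i} \<rightarrow>\<^sub>E UNIV. s i \<in> B}"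
      by (auto simp: cylinder_def)
    then show ?thesis
      using that by blast
  qed
  have "{{f \<in> I \<rightarrow>\<^sub>E UNIV. f i \<in> B} |i B. i \<in> I \<and> B \<in> sets (measure_pmf (bernoulli_pmf (1 - F i)))}
      \<subseteq> sigma_sets (I \<rightarrow>\<^sub>E UNIV) ?A"
  proof (intro subsetI)
    fix X assume "X \<in> {{f \<in> I \<rightarrow>\<^sub>E UNIV. f i \<in> B} |i B. i \<in> I \<and> B \<in> sets (measure_pmf (bernoulli_pmf (1 - F i)))}"
    then obtain i and B where X: "i \<in> I" "X = {f \<in> I \<rightarrow>\<^sub>E UNIV. f i \<in> B}"
      by blast
    show "X \<in> sigma_sets (I \<rightarrow>\<^sub>E UNIV) ?A"
      unfolding X(2) by (rule sigma_sets.Basic) (rule single[OF X(1)])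
  qed
  then show "sets (bernoulli_space I F) \<subseteq> sigma_sets (I \<rightarrow>\<^sub>E UNIV) ?A"
    unfolding bernoulli_space_def sets_PiM_single space_measure_pmf
    by (rule sigma_sets_mono)
qed

section \<open>Comparing product measures on all measurable sets\<close>

text \<open>Both measures are approximated by the same set \<open>V\<close>, which is what is needed to pass to the
  limit in an inequality that relates them. The sets that can be approximated form a
  \<open>\<sigma>\<close>-algebra, because \<open>m = M + N\<close> is subadditive and continuous along increasing unions.\<close>

lemma approximation_by_algebra_two_measures:
  fixes M N :: "'a measure" and A :: "'a set set" and \<epsilon> :: real
  assumes "finite_measure M" "finite_measure N" "sets N = sets M"
    and "algebra \<Omega> A" "sets M = sigma_sets \<Omega> A"
    and "U \<in> sets M" "0 < \<epsilon>"
  shows "\<exists>V\<in>A. measure M (sym_diff U V) + measure N (sym_diff U V) < \<epsilon>"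
proof -
  interpret M: finite_measure M by fact
  interpret N: finite_measure N by fact
  interpret A: algebra \<Omega> A by fact
  define m where "m U = measure M U + measure N U" for U
  have AM: "V \<in> sets M" if "V \<in> A" for V
    using that assms(5) by auto
  have space: "space M = \<Omega>"
    using sets_eq_imp_space_eq[of M "sigma \<Omega> A"] assms(5) A.space_closed by simp
  have mono: "m X \<le> m Y" if "X \<subseteq> Y" "Y \<in> sets M" for X Y
    unfolding m_def using that assms(3)
    by (intro add_mono M.finite_measure_mono N.finite_measure_mono) auto
  have subadd: "m (X \<union> Y) \<le> m X + m Y" if "X \<in> sets M" "Y \<in> sets M" for X Y
    using measure_Un_le[of X M Y] measure_Un_le[of X N Y] that assms(3)
    by (simp add: m_def)
  define P where "P U \<longleftrightarrow> U \<in> sets M \<and> (\<forall>e>0. \<exists>V\<in>A. m (sym_diff U V) < e)" for U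
  have P_trans: "P U" if U: "U \<in> sets M" and W: "\<And>e. e > 0 \<Longrightarrow> \<exists>W. P W \<and> m (sym_diff U W) < e" for U
    unfolding P_def
  proof (intro conjI allI impI U)
    fix e :: real assume "e > 0"
    then obtain W where W: "P W" "m (sym_diff U W) < e / 2"
      using W[of "e / 2"] by auto
    then obtain V where V: "V \<in> A" "m (sym_diff W V) < e / 2"
      using \<open>e > 0\<close> unfolding P_def by (meson half_gt_zero)
    have S: "V \<in> sets M" "W \<in> sets M"
      using V W AM by (auto simp: P_def)
    have "m (sym_diff U V) \<le> m (sym_diff U W \<union> sym_diff W V)"
      by (intro mono sets.Un sets.Diff S U) auto
    also have "\<dots> \<le> m (sym_diff U W) + m (sym_diff W V)"
      by (intro subadd sets.Un sets.Diff S U)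
    finally show "\<exists>V\<in>A. m (sym_diff U V) < e"
      using V W by (intro bexI[of _ V]) auto
  qed
  have P_A: "P V" if "V \<in> A" for V
    using that AM by (auto simp: P_def m_def intro!: bexI[of _ V])
  have P_Un: "P (U \<union> W)" if U: "P U" and W: "P W" for U W
    unfolding P_def
  proof (intro conjI allI impI)
    show "U \<union> W \<in> sets M"
      using U W by (auto simp: P_def)
    fix e :: real assume "e > 0"
    then obtain V V' where V: "V \<in> A" "m (sym_diff U V) < e / 2"
      "V' \<in> A" "m (sym_diff W V') < e / 2"
      using U W unfolding P_def by (meson half_gt_zero)
    have S: "V \<in> sets M" "V' \<in> sets M" "U \<in> sets M" "W \<in> sets M"
      using V U W AM by (auto simp: P_def)
    have "m (sym_diff (U \<union> W) (V \<union> V')) \<le> m (sym_diff U V \<union> sym_diff W V')"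
      by (intro mono sets.Un sets.Diff S) auto
    also have "\<dots> \<le> m (sym_diff U V) + m (sym_diff W V')"
      by (intro subadd sets.Un sets.Diff S)
    finally show "\<exists>V\<in>A. m (sym_diff (U \<union> W) V) < e"
      using V by (intro bexI[of _ "V \<union> V'"]) auto
  qed
  have "P U" if "U \<in> sigma_sets \<Omega> A" for U
    using that
  proof induction
    case (Basic V)
    then show ?case by (rule P_A)
  next
    case Empty
    show ?case by (rule P_A) simp
  next
    case (Compl U)
    have U: "U \<subseteq> \<Omega>"
      using Compl(1) A.space_closed sigma_sets_into_sp by metis
    show ?case
      unfolding P_def
    proof (intro conjI allI impI)
      show "\<Omega> - U \<in> sets M"
        using Compl(2) by (auto simp: P_def simp flip: space)
      fix e :: real assume "e > 0"
      then obtain V where V: "V \<in> A" "m (sym_diff U V) < e"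
        using Compl(2) by (auto simp: P_def)
      then have "sym_diff (\<Omega> - U) (\<Omega> - V) = sym_diff U V"
        using U A.space_closed by auto
      then show "\<exists>V\<in>A. m (sym_diff (\<Omega> - U) V) < e"
        using V by (intro bexI[of _ "\<Omega> - V"]) auto
    qed
  next
    case (Union U)
    have U: "U n \<in> sets M" for n
      using Union(2) by (auto simp: P_def)
    define W where "W n = (\<Union>k<n. U k)" for n
    have P_W: "P (W n)" for n
    proof (induction n)
      case 0
      show ?case by (rule P_A) (simp add: W_def)
    next
      case (Suc n)
      then show ?case
        using P_Un[OF Union(2)[of n] Suc] by (simp add: W_def lessThan_Suc)
    qed
    have inc: "incseq W"
      by (rule incseq_SucI) (auto simp: W_def lessThan_Suc)
    have W: "W n \<in> sets M" "W n \<in> sets N" for n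
      using P_W[of n] assms(3) by (auto simp: P_def)
    have UW: "(\<Union>n. W n) = (\<Union>n. U n)"
      by (auto simp: W_def)
    have "(\<lambda>n. m (W n)) \<longlonglongrightarrow> m (\<Union>n. W n)"
      unfolding m_def using W inc
      by (intro tendsto_add M.finite_Lim_measure_incseq N.finite_Lim_measure_incseq) auto
    then have lim: "(\<lambda>n. m (\<Union>n. U n) - m (W n)) \<longlonglongrightarrow> 0"
      unfolding UW using tendsto_diff[OF tendsto_const[of "m (\<Union>n. U n)"]] by force
    show ?case
    proof (rule P_trans)
      show "(\<Union>n. U n) \<in> sets M"
        using U by auto
      fix e :: real assume "e > 0"
      then have "eventually (\<lambda>n. m (\<Union>n. U n) - m (W n) < e) sequentially"
        using lim by (auto intro: order_tendstoD)
      then obtain n where n: "m (\<Union>n. U n) - m (W n) < e"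
        by (auto simp: eventually_sequentially)
      have sub: "W n \<subseteq> (\<Union>n. U n)"
        by (auto simp: W_def)
      then have "sym_diff (\<Union>n. U n) (W n) = (\<Union>n. U n) - W n"
        by auto
      moreover have "m ((\<Union>n. U n) - W n) = m (\<Union>n. U n) - m (W n)"
        using sub U W assms(3)
        by (simp add: m_def M.finite_measure_Diff N.finite_measure_Diff sets.countable_UN)
      ultimately show "\<exists>W. P W \<and> m (sym_diff (\<Union>n. U n) W) < e"
        using n P_W[of n] by auto
    qed
  qed
  then show ?thesis
    using assms by (auto simp: P_def m_def)
qed

lemma pmf_bernoulli_values:
  assumes "F i \<in> {0<..<1::real}"
  shows "pmf (bernoulli_pmf (1 - F i)) False = F i" "pmf (bernoulli_pmf (1 - F i)) True = 1 - F i"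
    "0 < pmf (bernoulli_pmf (1 - F i)) b"
proof -
  show 1: "pmf (bernoulli_pmf (1 - F i)) False = F i" "pmf (bernoulli_pmf (1 - F i)) True = 1 - F i"
    using assms by simp_all
  show "0 < pmf (bernoulli_pmf (1 - F i)) b"
    using assms by (cases b) (simp_all only: 1, simp_all)
qed

text \<open>Let \<open>P s\<close> and \<open>Q s\<close> be the two probabilities of a pattern \<open>s\<close>. By the Cauchy-Schwarz
  inequality \<open>(\<Sum>s\<in>S. P s)\<^sup>2 \<le> (\<Sum>s\<in>S. Q s) (\<Sum>s\<in>S. (P s)\<^sup>2 / Q s)\<close>. Extended to all patterns, the
  last sum factorises over the coordinates.\<close>

lemma bernoulli_cylinder_measure_square_le:
  fixes F F' :: "'i \<Rightarrow> real"
  assumes "0 < \<delta>" "\<And>i. i \<in> I \<Longrightarrow> F i \<in> {\<delta>..1 - \<delta>}" "\<And>i. i \<in> I \<Longrightarrow> F' i \<in> {\<delta>..1 - \<delta>}"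
    and "finite J" "J \<subseteq> I" "S \<subseteq> J \<rightarrow>\<^sub>E UNIV"
  shows "(measure (bernoulli_space I F) (cylinder I J S))\<^sup>2
    \<le> measure (bernoulli_space I F') (cylinder I J S) * exp ((\<Sum>i\<in>J. (F i - F' i)\<^sup>2) / \<delta>\<^sup>2)"
proof -
  define p q where "p = (\<lambda>i b. pmf (bernoulli_pmf (1 - F i)) b)"
    and "q = (\<lambda>i b. pmf (bernoulli_pmf (1 - F' i)) b)"
  define P Q where "P = (\<lambda>s. \<Prod>i\<in>J. p i (s i))" and "Q = (\<lambda>s. \<Prod>i\<in>J. q i (s i))"
  have F: "F i \<in> {0<..<1}" "F' i \<in> {0<..<1}" if "i \<in> J" for i
    using assms(1) assms(2,3)[of i] assms(5) that by auto
  have Q: "0 < Q s" for s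
    unfolding Q_def q_def using F by (intro prod_pos) (auto intro!: pmf_bernoulli_values)
  have P: "0 \<le> P s" for s
    unfolding P_def p_def by (intro prod_nonneg) auto
  have fin: "finite (J \<rightarrow>\<^sub>E (UNIV :: bool set))"
    by (rule finite_PiE[OF assms(4)]) simp
  have "(\<Sum>s\<in>J \<rightarrow>\<^sub>E UNIV. (P s)\<^sup>2 / Q s)
      = (\<Sum>s\<in>J \<rightarrow>\<^sub>E UNIV. \<Prod>i\<in>J. (p i (s i))\<^sup>2 / q i (s i))"
    by (simp add: P_def Q_def prod_power_distrib prod_dividef)
  also have "\<dots> = (\<Prod>i\<in>J. (p i False)\<^sup>2 / q i False + (p i True)\<^sup>2 / q i True)"
    by (rule sum_PiE_prod_bool[OF assms(4)])
  also have "\<dots> \<le> (\<Prod>i\<in>J. exp ((F i - F' i)\<^sup>2 / \<delta>\<^sup>2))"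
  proof (rule prod_mono, intro conjI)
    fix i assume i: "i \<in> J"
    have "(F i)\<^sup>2 / F' i + (1 - F i)\<^sup>2 / (1 - F' i) \<le> exp ((F i - F' i)\<^sup>2 / \<delta>\<^sup>2)"
      using assms(1) assms(2,3)[of i] assms(5) i by (intro two_point_chi_square_le) auto
    then show "(p i False)\<^sup>2 / q i False + (p i True)\<^sup>2 / q i True \<le> exp ((F i - F' i)\<^sup>2 / \<delta>\<^sup>2)"
      using F[OF i] by (simp add: p_def q_def)
    show "0 \<le> (p i False)\<^sup>2 / q i False + (p i True)\<^sup>2 / q i True"
      by (simp add: p_def q_def)
  qed
  also have "\<dots> = exp ((\<Sum>i\<in>J. (F i - F' i)\<^sup>2) / \<delta>\<^sup>2)"
    by (simp add: exp_sum[OF assms(4)] sum_divide_distrib)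
  finally have chi: "(\<Sum>s\<in>J \<rightarrow>\<^sub>E UNIV. (P s)\<^sup>2 / Q s) \<le> exp ((\<Sum>i\<in>J. (F i - F' i)\<^sup>2) / \<delta>\<^sup>2)" .
  have "(\<Sum>s\<in>S. P s)\<^sup>2 = (\<Sum>s\<in>S. sqrt (Q s) * (P s / sqrt (Q s)))\<^sup>2"
    using Q by (simp add: less_imp_neq[symmetric])
  also have "\<dots> \<le> (\<Sum>s\<in>S. (sqrt (Q s))\<^sup>2) * (\<Sum>s\<in>S. (P s / sqrt (Q s))\<^sup>2)"
    by (rule Cauchy_Schwarz_ineq_sum)
  also have "\<dots> = (\<Sum>s\<in>S. Q s) * (\<Sum>s\<in>S. (P s)\<^sup>2 / Q s)"
    using Q by (simp add: power_divide less_imp_le)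
  also have "\<dots> \<le> (\<Sum>s\<in>S. Q s) * (\<Sum>s\<in>J \<rightarrow>\<^sub>E UNIV. (P s)\<^sup>2 / Q s)"
    using Q P assms(6) fin
    by (intro mult_left_mono sum_mono2 sum_nonneg) (auto simp: less_imp_le)
  also have "\<dots> \<le> (\<Sum>s\<in>S. Q s) * exp ((\<Sum>i\<in>J. (F i - F' i)\<^sup>2) / \<delta>\<^sup>2)"
    using Q by (intro mult_left_mono[OF chi] sum_nonneg) (simp add: less_imp_le)
  finally have "(\<Sum>s\<in>S. P s)\<^sup>2 \<le> (\<Sum>s\<in>S. Q s) * exp ((\<Sum>i\<in>J. (F i - F' i)\<^sup>2) / \<delta>\<^sup>2)" .
  then show ?thesis
    using assms(4-6) by (simp add: measure_cylinder P_def Q_def p_def q_def)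
qed

text \<open>This quantitative form of one half of Kakutani's theorem gives the nonsingularity of the
  action and the lower bound on the measures of translates behind conservativity. The bound for
  cylinders does not depend on the number of coordinates, so it survives approximation.\<close>

lemma bernoulli_measure_square_le:
  fixes F F' :: "'i \<Rightarrow> real"
  assumes "0 < \<delta>" "\<And>i. i \<in> I \<Longrightarrow> F i \<in> {\<delta>..1 - \<delta>}" "\<And>i. i \<in> I \<Longrightarrow> F' i \<in> {\<delta>..1 - \<delta>}"
    and "(\<lambda>i. (F i - F' i)\<^sup>2) summable_on I"
    and "U \<in> sets (bernoulli_space I F)"
  shows "(measure (bernoulli_space I F) U)\<^sup>2
    \<le> measure (bernoulli_space I F') U * exp ((\<Sum>\<^sub>\<infinity>i\<in>I. (F i - F' i)\<^sup>2) / \<delta>\<^sup>2)"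
proof -
  let ?M = "bernoulli_space I F" and ?N = "bernoulli_space I F'"
  let ?C = "exp ((\<Sum>\<^sub>\<infinity>i\<in>I. (F i - F' i)\<^sup>2) / \<delta>\<^sup>2)"
  define A where "A = {cylinder I J S |J S. finite J \<and> J \<subseteq> I \<and> S \<subseteq> J \<rightarrow>\<^sub>E UNIV}"
  interpret M: prob_space ?M by (rule prob_space_bernoulli_space)
  interpret N: prob_space ?N by (rule prob_space_bernoulli_space)
  have NM: "sets ?N = sets ?M"
    by (rule sets_bernoulli_space_cong)
  have cyl: "V \<in> sets ?M \<and> (measure ?M V)\<^sup>2 \<le> measure ?N V * ?C" if "V \<in> A" for V
  proof -
    note VA = that
    obtain J S where V: "V = cylinder I J S" "finite J" "J \<subseteq> I" "S \<subseteq> J \<rightarrow>\<^sub>E UNIV"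
      using VA unfolding A_def by blast
    have "(\<Sum>i\<in>J. (F i - F' i)\<^sup>2) \<le> (\<Sum>\<^sub>\<infinity>i\<in>I. (F i - F' i)\<^sup>2)"
      using assms(4) V by (intro finite_sum_le_infsum) auto
    then have "measure ?N V * exp ((\<Sum>i\<in>J. (F i - F' i)\<^sup>2) / \<delta>\<^sup>2) \<le> measure ?N V * ?C"
      using assms(1) by (intro mult_left_mono) (auto simp: divide_right_mono)
    then show ?thesis
      using order_trans[OF bernoulli_cylinder_measure_square_le[of \<delta> I F F' J S]] assms(1-3) V
      by (simp add: measure_cylinder(1))
  qed
  have alg: "algebra (I \<rightarrow>\<^sub>E UNIV) A"
    unfolding A_def by (rule cylinder_algebra)
  have gen: "sets ?M = sigma_sets (I \<rightarrow>\<^sub>E UNIV) A"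
    unfolding A_def by (rule sets_bernoulli_space_eq_sigma_sets)
  have "\<exists>V\<in>A. measure ?M (sym_diff U V) + measure ?N (sym_diff U V) < 1 / Suc n" for n
    by (rule approximation_by_algebra_two_measures[OF M.finite_measure_axioms
      N.finite_measure_axioms NM alg gen assms(5)]) simp
  then have "\<forall>n. \<exists>V. V \<in> A \<and> measure ?M (sym_diff U V) + measure ?N (sym_diff U V) < 1 / Suc n"
    by (simp only: Bex_def) blast
  from choice[OF this] obtain V where
    *: "\<forall>n. V n \<in> A \<and> measure ?M (sym_diff U (V n)) + measure ?N (sym_diff U (V n)) < 1 / Suc n" ..
  have V: "V n \<in> A" "measure ?M (sym_diff U (V n)) + measure ?N (sym_diff U (V n)) < 1 / Suc n" for n
    using spec[OF *, of n] by (simp_all only: simp_thms)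
  have lim0: "(\<lambda>n. 1 / Suc n) \<longlonglongrightarrow> (0 :: real)"
    using LIMSEQ_inverse_real_of_nat by (simp add: inverse_eq_divide)
  have diff_le: "\<bar>measure K X - measure K Y\<bar> \<le> measure K (sym_diff X Y)"
    if "finite_measure K" "X \<in> sets K" "Y \<in> sets K" for K :: "('i \<Rightarrow> bool) measure" and X Y
  proof -
    interpret K: finite_measure K by fact
    have "measure K X \<le> measure K (Y \<union> sym_diff X Y)" "measure K Y \<le> measure K (X \<union> sym_diff X Y)"
      using that by (auto intro!: K.finite_measure_mono)
    moreover have "measure K (Y \<union> sym_diff X Y) \<le> measure K Y + measure K (sym_diff X Y)"
      "measure K (X \<union> sym_diff X Y) \<le> measure K X + measure K (sym_diff X Y)"
      using that by (auto intro!: measure_Un_le)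
    ultimately show ?thesis by linarith
  qed
  have Vsets: "V n \<in> sets ?M" "V n \<in> sets ?N" "U \<in> sets ?N" for n
    using cyl[OF V(1)] assms(5) NM by auto
  have dist: "norm (measure ?M (V n) - measure ?M U) \<le> 1 / Suc n"
    "norm (measure ?N (V n) - measure ?N U) \<le> 1 / Suc n" for n
  proof -
    have "\<bar>measure ?M U - measure ?M (V n)\<bar> \<le> measure ?M (sym_diff U (V n))"
      "\<bar>measure ?N U - measure ?N (V n)\<bar> \<le> measure ?N (sym_diff U (V n))"
      using Vsets assms(5) by (auto intro!: diff_le M.finite_measure_axioms N.finite_measure_axioms)
    moreover have "0 \<le> measure ?M (sym_diff U (V n))" "0 \<le> measure ?N (sym_diff U (V n))"
      by auto
    ultimately show "norm (measure ?M (V n) - measure ?M U) \<le> 1 / Suc n"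
      "norm (measure ?N (V n) - measure ?N U) \<le> 1 / Suc n"
      using V(2)[of n] unfolding real_norm_def by linarith+
  qed
  have "(\<lambda>n. measure ?M (V n)) \<longlonglongrightarrow> measure ?M U" "(\<lambda>n. measure ?N (V n)) \<longlonglongrightarrow> measure ?N U"
    using dist by (auto intro!: LIM_zero_cancel[OF tendsto_0_le[OF lim0, of _ 1]] always_eventually
      simp: abs_minus_commute)
  then have "(\<lambda>n. (measure ?M (V n))\<^sup>2) \<longlonglongrightarrow> (measure ?M U)\<^sup>2"
    "(\<lambda>n. measure ?N (V n) * ?C) \<longlonglongrightarrow> measure ?N U * ?C"
    by (auto intro!: tendsto_intros)
  then show ?thesis
    by (rule LIMSEQ_le) (use cyl[OF V(1)] in blast)
qed

section \<open>The Hellinger affinity\<close>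

text \<open>This is the Cauchy-Schwarz inequality for \<open>\<surd>w\<close> and \<open>1\<close> on \<open>A\<close>. It follows from the inequality
  between arithmetic and geometric means with weights balanced so that both terms on the right
  integrate to the same value.\<close>

lemma nn_integral_sqrt_density_le:
  fixes w :: "'a \<Rightarrow> real"
  assumes [measurable]: "w \<in> borel_measurable M" "A \<in> sets M" and "\<And>x. 0 \<le> w x"
    and "finite_measure M" "finite_measure (density M w)"
    and "0 < measure M A" "0 < measure (density M w) A"
  shows "(\<integral>\<^sup>+x. ennreal (sqrt (w x)) * indicator A x \<partial>M)
    \<le> ennreal (sqrt (measure M A * measure (density M w) A))"
proof -
  interpret M: finite_measure M by fact
  interpret N: finite_measure "density M w" by fact
  define m n where "m = sqrt (measure M A)" and "n = sqrt (measure (density M w) A)"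
  have mn: "0 < m" "0 < n" "m\<^sup>2 = measure M A" "n\<^sup>2 = measure (density M w) A"
    using assms by (simp_all add: m_def n_def)
  have "sqrt (w x) \<le> m / (2 * n) * w x + n / (2 * m)" for x
  proof -
    have "(sqrt (w x) * m - n)\<^sup>2 / (2 * m * n) \<ge> 0"
      using mn by simp
    moreover have "(sqrt (w x) * m - n)\<^sup>2 = w x * m\<^sup>2 - 2 * m * n * sqrt (w x) + n\<^sup>2"
      using assms(3)[of x] by (simp add: power2_diff power_mult_distrib)
    ultimately show ?thesis
      using mn by (simp add: field_simps power2_eq_square)
  qed
  then have "(\<integral>\<^sup>+x. ennreal (sqrt (w x)) * indicator A x \<partial>M)
      \<le> (\<integral>\<^sup>+x. ennreal (m / (2 * n)) * (ennreal (w x) * indicator A x)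
              + ennreal (n / (2 * m)) * indicator A x \<partial>M)"
    using mn assms(3)
    by (intro nn_integral_mono) (auto simp: indicator_def simp flip: ennreal_mult' ennreal_plus)
  also have "\<dots> = ennreal (m / (2 * n)) * emeasure (density M w) A
      + ennreal (n / (2 * m)) * emeasure M A"
    by (simp add: nn_integral_add nn_integral_cmult emeasure_density)
  also have "\<dots> = ennreal (m / (2 * n) * n\<^sup>2 + n / (2 * m) * m\<^sup>2)"
    using mn by (simp add: M.emeasure_eq_measure N.emeasure_eq_measure
      flip: ennreal_mult' ennreal_plus)
  also have "m / (2 * n) * n\<^sup>2 + n / (2 * m) * m\<^sup>2 = m * n"
    using mn(1,2) by (simp add: field_simps power2_eq_square)
  finally show ?thesis
    by (simp add: m_def n_def real_sqrt_mult)
qed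

text \<open>The affinity only increases when the measures are coarsened to a finite partition. For the
  partition into cylinders over a finite set \<open>J\<close> it is a product over \<open>J\<close> of affinities of
  two-point laws, and \<open>J\<close> is arbitrary.\<close>

lemma bernoulli_affinity_le:
  fixes F F' :: "'i \<Rightarrow> real" and w :: "('i \<Rightarrow> bool) \<Rightarrow> real"
  assumes F: "\<And>i. i \<in> I \<Longrightarrow> F i \<in> {0<..<1}" "\<And>i. i \<in> I \<Longrightarrow> F' i \<in> {0<..<1}"
    and sum: "(\<lambda>i. (F i - F' i)\<^sup>2) summable_on I"
    and w: "w \<in> borel_measurable (bernoulli_space I F)" "\<And>x. 0 \<le> w x"
    and dens: "bernoulli_space I F' = density (bernoulli_space I F) w"
  shows "(\<integral>\<^sup>+x. ennreal (sqrt (w x)) \<partial>bernoulli_space I F)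
    \<le> ennreal (exp (- (\<Sum>\<^sub>\<infinity>i\<in>I. (F i - F' i)\<^sup>2) / 2))"
proof -
  let ?M = "bernoulli_space I F" and ?N = "bernoulli_space I F'"
  interpret M: prob_space ?M by (rule prob_space_bernoulli_space)
  interpret N: prob_space ?N by (rule prob_space_bernoulli_space)
  note [measurable] = w(1)
  have fin: "(\<integral>\<^sup>+x. ennreal (sqrt (w x)) \<partial>?M) \<le> ennreal (exp (- (\<Sum>i\<in>J. (F i - F' i)\<^sup>2) / 2))"
    if J: "finite J" "J \<subseteq> I" for J
  proof -
    let ?c = "\<lambda>s. cylinder I J {s}"
    let ?p = "\<lambda>i b. pmf (bernoulli_pmf (1 - F i)) b" and ?q = "\<lambda>i b. pmf (bernoulli_pmf (1 - F' i)) b"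
    have FJ: "F i \<in> {0<..<1}" "F' i \<in> {0<..<1}" if "i \<in> J" for i
      using F J(2) that by auto
    have finJ: "finite (J \<rightarrow>\<^sub>E (UNIV :: bool set))"
      by (rule finite_PiE[OF J(1)]) simp
    have sqrt_prod: "sqrt (\<Prod>i\<in>J. f i) = (\<Prod>i\<in>J. sqrt (f i))" for f :: "'i \<Rightarrow> real"
      using J(1) by induction (simp_all add: real_sqrt_mult)
    have c: "?c s \<in> sets ?M" "measure ?M (?c s) = (\<Prod>i\<in>J. ?p i (s i))"
      "measure ?N (?c s) = (\<Prod>i\<in>J. ?q i (s i))" if "s \<in> J \<rightarrow>\<^sub>E UNIV" for s
      using measure_cylinder_singleton[OF J that] by blast+
    have one: "(\<Sum>s\<in>J \<rightarrow>\<^sub>E UNIV. indicator (?c s) x) = (1 :: ennreal)" if "x \<in> space ?M" for x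
    proof -
      have "(\<Sum>s\<in>J \<rightarrow>\<^sub>E UNIV. indicator (?c s) x)
          = (\<Sum>s\<in>J \<rightarrow>\<^sub>E UNIV. if s = restrict x J then 1 else (0 :: ennreal))"
        using that by (intro sum.cong refl) (auto simp: cylinder_def indicator_def)
      also have "\<dots> = 1"
        using finJ by (simp add: sum.delta)
      finally show ?thesis .
    qed
    have "(\<integral>\<^sup>+x. ennreal (sqrt (w x)) \<partial>?M)
        = (\<integral>\<^sup>+x. (\<Sum>s\<in>J \<rightarrow>\<^sub>E UNIV. ennreal (sqrt (w x)) * indicator (?c s) x) \<partial>?M)"
      by (intro nn_integral_cong) (simp add: one flip: sum_distrib_left)
    also have "\<dots> = (\<Sum>s\<in>J \<rightarrow>\<^sub>E UNIV. \<integral>\<^sup>+x. ennreal (sqrt (w x)) * indicator (?c s) x \<partial>?M)"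
      using c(1) by (intro nn_integral_sum borel_measurable_times_ennreal borel_measurable_indicator)
        measurable
    also have "\<dots> \<le> (\<Sum>s\<in>J \<rightarrow>\<^sub>E UNIV. ennreal (\<Prod>i\<in>J. sqrt (?p i (s i) * ?q i (s i))))"
    proof (rule sum_mono)
      fix s assume s: "s \<in> J \<rightarrow>\<^sub>E (UNIV :: bool set)"
      have "0 < measure ?M (?c s)" "0 < measure ?N (?c s)"
        unfolding c[OF s] using FJ by (auto intro!: prod_pos pmf_bernoulli_values)
      then have "(\<integral>\<^sup>+x. ennreal (sqrt (w x)) * indicator (?c s) x \<partial>?M)
          \<le> ennreal (sqrt (measure ?M (?c s) * measure ?N (?c s)))"
        unfolding dens using c(1)[OF s] w M.finite_measure_axioms N.finite_measure_axioms[unfolded dens]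
        by (intro nn_integral_sqrt_density_le) auto
      also have "sqrt (measure ?M (?c s) * measure ?N (?c s)) = (\<Prod>i\<in>J. sqrt (?p i (s i) * ?q i (s i)))"
        by (simp add: c[OF s] sqrt_prod flip: prod.distrib)
      finally show "(\<integral>\<^sup>+x. ennreal (sqrt (w x)) * indicator (?c s) x \<partial>?M)
          \<le> ennreal (\<Prod>i\<in>J. sqrt (?p i (s i) * ?q i (s i)))" .
    qed
    also have "\<dots> = ennreal (\<Sum>s\<in>J \<rightarrow>\<^sub>E UNIV. \<Prod>i\<in>J. sqrt (?p i (s i) * ?q i (s i)))"
      by (rule sum_ennreal) (auto intro!: prod_nonneg)
    also have "(\<Sum>s\<in>J \<rightarrow>\<^sub>E UNIV. \<Prod>i\<in>J. sqrt (?p i (s i) * ?q i (s i)))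
        = (\<Prod>i\<in>J. sqrt (?p i False * ?q i False) + sqrt (?p i True * ?q i True))"
      by (rule sum_PiE_prod_bool[OF J(1)])
    also have "\<dots> \<le> (\<Prod>i\<in>J. exp (- (F i - F' i)\<^sup>2 / 2))"
    proof (intro prod_mono conjI)
      fix i assume i: "i \<in> J"
      show "0 \<le> sqrt (?p i False * ?q i False) + sqrt (?p i True * ?q i True)"
        by simp
      have "sqrt (F i * F' i) + sqrt ((1 - F i) * (1 - F' i)) \<le> exp (- (F i - F' i)\<^sup>2 / 2)"
        using FJ[OF i] by (intro two_point_affinity_le) auto
      then show "sqrt (?p i False * ?q i False) + sqrt (?p i True * ?q i True) \<le> exp (- (F i - F' i)\<^sup>2 / 2)"
        using FJ[OF i] by simp
    qed
    also have "\<dots> = exp (- (\<Sum>i\<in>J. (F i - F' i)\<^sup>2) / 2)"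
      by (simp add: exp_sum[OF J(1), symmetric] sum_negf sum_divide_distrib)
    finally show ?thesis
      by (simp add: ennreal_leI)
  qed
  have "((\<lambda>J. ennreal (exp (- (\<Sum>i\<in>J. (F i - F' i)\<^sup>2) / 2)))
      \<longlongrightarrow> ennreal (exp (- (\<Sum>\<^sub>\<infinity>i\<in>I. (F i - F' i)\<^sup>2) / 2))) (finite_subsets_at_top I)"
    using has_sum_infsum[OF sum] unfolding has_sum_def
    by (intro tendsto_ennrealI tendsto_intros) auto
  then show ?thesis
    using fin by (rule tendsto_lowerbound[OF _ eventually_finite_subsets_at_top_weakI]) auto
qed

section \<open>Nonsingularity of the Bernoulli action\<close>

lemma group_action_bernoulli_action:
  assumes "group G" "group_action G I \<phi>"
  shows "group_action G (I \<rightarrow>\<^sub>E UNIV) (bernoulli_action G I \<phi>)"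
proof -
  interpret G: group G by fact
  interpret A: group_action G I \<phi> by fact
  let ?T = "bernoulli_action G I \<phi>" and ?X = "I \<rightarrow>\<^sub>E (UNIV :: bool set)"
  have into: "?T g x \<in> ?X" if "x \<in> ?X" for g x
    using that by (simp add: bernoulli_action_def)
  have mult: "?T (g \<otimes>\<^bsub>G\<^esub> h) x = ?T g (?T h x)" if "g \<in> carrier G" "h \<in> carrier G" "x \<in> ?X" for g h x
  proof -
    have "\<phi> (inv\<^bsub>G\<^esub> (g \<otimes>\<^bsub>G\<^esub> h)) i = \<phi> (inv\<^bsub>G\<^esub> h) (\<phi> (inv\<^bsub>G\<^esub> g) i)"
      and "\<phi> (inv\<^bsub>G\<^esub> g) i \<in> I" if "i \<in> I" for i
      using that \<open>g \<in> carrier G\<close> \<open>h \<in> carrier G\<close>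
      by (auto simp: G.inv_mult_group A.composition_rule intro: A.element_image)
    then show ?thesis
      using that into[OF that(3), of h] by (auto simp: bernoulli_action_def restrict_def fun_eq_iff)
  qed
  have one: "?T \<one>\<^bsub>G\<^esub> x = x" if "x \<in> ?X" for x
  proof -
    have "\<phi> \<one>\<^bsub>G\<^esub> i = i" if "i \<in> I" for i
      using fun_cong[OF A.id_eq_one, of i] that by simp
    then have "?T \<one>\<^bsub>G\<^esub> x i = x i" for i
      using that by (cases "i \<in> I") (auto simp: bernoulli_action_def PiE_def extensional_def)
    then show ?thesis by blast
  qed
  have bij: "?T g \<in> Bij ?X" if g: "g \<in> carrier G" for g
  proof -
    have "bij_betw (?T g) ?X ?X"
      by (rule bij_betwI[where g = "?T (inv\<^bsub>G\<^esub> g)"])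
        (use g in \<open>auto simp: into one simp flip: mult\<close>)
    then show ?thesis
      by (simp add: Bij_def bernoulli_action_def)
  qed
  have "?T \<in> hom G (BijGroup ?X)"
  proof (rule homI)
    fix g h assume gh: "g \<in> carrier G" "h \<in> carrier G"
    show "?T (g \<otimes>\<^bsub>G\<^esub> h) = ?T g \<otimes>\<^bsub>BijGroup ?X\<^esub> ?T h"
    proof (rule extensionalityI[of _ ?X])
      show "?T (g \<otimes>\<^bsub>G\<^esub> h) \<in> extensional ?X"
        by (simp add: bernoulli_action_def)
      show "?T g \<otimes>\<^bsub>BijGroup ?X\<^esub> ?T h \<in> extensional ?X"
        using gh bij by (simp add: BijGroup_def)
      fix x assume "x \<in> ?X"
      then show "?T (g \<otimes>\<^bsub>G\<^esub> h) x = (?T g \<otimes>\<^bsub>BijGroup ?X\<^esub> ?T h) x"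
        using gh bij mult by (simp add: BijGroup_def compose_eq)
    qed
  qed (use bij in \<open>simp add: BijGroup_def\<close>)
  then show ?thesis
    by (intro group_action.intro group_hom.intro group_hom_axioms.intro group_BijGroup G.is_group)
qed

text \<open>Permuting coordinates carries a product measure to the product measure with permuted factors,
  so all questions about translates become comparisons of two product measures.\<close>

lemma distr_bernoulli_action:
  assumes "group G" "group_action G I \<phi>" "g \<in> carrier G"
  shows "bernoulli_action G I \<phi> g \<in> measurable (bernoulli_space I F) (bernoulli_space I F)"
    and "distr (bernoulli_space I F) (bernoulli_space I F) (bernoulli_action G I \<phi> g)
      = bernoulli_space I (\<lambda>i. F (\<phi> (inv\<^bsub>G\<^esub> g) i))"
proof -
  interpret G: group G by fact
  interpret A: group_action G I \<phi> by fact
  let ?f = "\<phi> (inv\<^bsub>G\<^esub> g)" and ?m = "\<lambda>i. measure_pmf (bernoulli_pmf (1 - F i))"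
  have f: "inj_on ?f I" "?f \<in> I \<rightarrow> I"
    using assms(3) by (auto intro: A.inj_prop A.element_image)
  have restr: "bernoulli_action G I \<phi> g x = (\<lambda>i\<in>I. x (?f i))" if "x \<in> space (bernoulli_space I F)" for x
    using that by (simp add: bernoulli_action_def)
  have sets: "sets (bernoulli_space I F) = sets (bernoulli_space I (\<lambda>i. F (?f i)))"
    by (rule sets_bernoulli_space_cong)
  have "(\<lambda>x. \<lambda>i\<in>I. x (?f i)) \<in> measurable (bernoulli_space I F) (\<Pi>\<^sub>M i\<in>I. ?m (?f i))"
    unfolding bernoulli_space_def using f(2) by (intro measurable_restrict measurable_component_singleton) auto
  then have "bernoulli_action G I \<phi> g \<in> measurable (bernoulli_space I F) (\<Pi>\<^sub>M i\<in>I. ?m (?f i))"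
    by (subst measurable_cong[OF restr])
  moreover have "measurable (bernoulli_space I F) (bernoulli_space I F)
      = measurable (bernoulli_space I F) (\<Pi>\<^sub>M i\<in>I. ?m (?f i))"
    using sets by (intro measurable_cong_sets) (simp_all only: bernoulli_space_def)
  ultimately show "bernoulli_action G I \<phi> g \<in> measurable (bernoulli_space I F) (bernoulli_space I F)"
    by simp
  have "distr (bernoulli_space I F) (bernoulli_space I F) (bernoulli_action G I \<phi> g)
      = distr (bernoulli_space I F) (\<Pi>\<^sub>M i\<in>I. ?m (?f i)) (\<lambda>x. \<lambda>i\<in>I. x (?f i))"
    using sets by (intro distr_cong restr) (simp_all add: bernoulli_space_def)
  also have "\<dots> = (\<Pi>\<^sub>M i\<in>I. ?m (?f i))"
    unfolding bernoulli_space_def using f by (intro distr_PiM_reindex prob_space_measure_pmf)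
  finally show "distr (bernoulli_space I F) (bernoulli_space I F) (bernoulli_action G I \<phi> g)
      = bernoulli_space I (\<lambda>i. F (?f i))"
    by (simp add: bernoulli_space_def)
qed

lemma ell2_norm_square: "(ell2_norm I f)\<^sup>2 = (\<Sum>\<^sub>\<infinity>i\<in>I. (f i)\<^sup>2)"
  unfolding ell2_norm_def by (rule real_sqrt_pow2) (simp add: infsum_nonneg)

lemma nonsingular_bernoulli_action:
  fixes F :: "'i \<Rightarrow> real"
  assumes G: "group G" "group_action G I \<phi>" and \<delta>: "0 < \<delta>"
    and F: "\<And>i. i \<in> I \<Longrightarrow> F i \<in> {\<delta>..1 - \<delta>}"
    and sum: "\<And>g. g \<in> carrier G \<Longrightarrow> (\<lambda>i. (F i - F (\<phi> (inv\<^bsub>G\<^esub> g) i))\<^sup>2) summable_on I"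
  shows "nonsingular_action G (bernoulli_space I F) (bernoulli_action G I \<phi>)"
proof -
  interpret G: group G by fact
  interpret A: group_action G I \<phi> by fact
  have ac: "absolutely_continuous (bernoulli_space I F1) (bernoulli_space I F2)"
    if F12: "\<And>i. i \<in> I \<Longrightarrow> F1 i \<in> {\<delta>..1 - \<delta>}" "\<And>i. i \<in> I \<Longrightarrow> F2 i \<in> {\<delta>..1 - \<delta>}"
      "(\<lambda>i. (F2 i - F1 i)\<^sup>2) summable_on I" for F1 F2 :: "'i \<Rightarrow> real"
    unfolding absolutely_continuous_def
  proof
    interpret N1: prob_space "bernoulli_space I F1" by (rule prob_space_bernoulli_space)
    interpret N2: prob_space "bernoulli_space I F2" by (rule prob_space_bernoulli_space)
    fix U assume "U \<in> null_sets (bernoulli_space I F1)"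
    then have U: "U \<in> sets (bernoulli_space I F2)" "measure (bernoulli_space I F1) U = 0"
      by (auto simp: sets_bernoulli_space_cong[of I F2 F1] measure_def)
    have "(measure (bernoulli_space I F2) U)\<^sup>2
        \<le> measure (bernoulli_space I F1) U * exp ((\<Sum>\<^sub>\<infinity>i\<in>I. (F2 i - F1 i)\<^sup>2) / \<delta>\<^sup>2)"
      by (rule bernoulli_measure_square_le[OF \<delta> _ _ that(3) U(1)]) (use F12 in auto)
    then show "U \<in> null_sets (bernoulli_space I F2)"
      using U by (auto simp: N2.emeasure_eq_measure)
  qed
  have F': "F (\<phi> (inv\<^bsub>G\<^esub> g) i) \<in> {\<delta>..1 - \<delta>}" if "g \<in> carrier G" "i \<in> I" for g i
    using that(2) A.element_image[OF G.inv_closed[OF that(1)] that(2) refl] by (intro F)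
  have sum': "(\<lambda>i. (F (\<phi> (inv\<^bsub>G\<^esub> g) i) - F i)\<^sup>2) summable_on I" if "g \<in> carrier G" for g
    using sum[OF that] by (simp only: power2_commute[of "F _" "F (\<phi> _ _)"])
  show ?thesis
    unfolding nonsingular_action_def space_bernoulli_space
  proof (intro conjI ballI)
    show "group_action G (I \<rightarrow>\<^sub>E UNIV) (bernoulli_action G I \<phi>)"
      by (rule group_action_bernoulli_action[OF G])
    fix g assume g: "g \<in> carrier G"
    show "bernoulli_action G I \<phi> g \<in> measurable (bernoulli_space I F) (bernoulli_space I F)"
      by (rule distr_bernoulli_action(1)[OF G g])
    show "absolutely_continuous (bernoulli_space I F)
        (distr (bernoulli_space I F) (bernoulli_space I F) (bernoulli_action G I \<phi> g))"
      unfolding distr_bernoulli_action(2)[OF G g] using F F'[OF g] sum'[OF g] by (rule ac)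
    show "absolutely_continuous
        (distr (bernoulli_space I F) (bernoulli_space I F) (bernoulli_action G I \<phi> g)) (bernoulli_space I F)"
      unfolding distr_bernoulli_action(2)[OF G g] using F'[OF g] F sum[OF g] by (rule ac)
  qed
qed

section \<open>A criterion for conservativity\<close>

lemma nonsingular_actionD:
  assumes "nonsingular_action G M a"
  shows "group_action G (space M) a"
    and "\<And>g. g \<in> carrier G \<Longrightarrow> a g \<in> measurable M M"
    and "\<And>g. g \<in> carrier G \<Longrightarrow> absolutely_continuous M (distr M M (a g))"
  using assms by (auto simp: nonsingular_action_def)

lemma AE_translate:
  assumes "nonsingular_action G M a" "g \<in> carrier G" "AE x in M. P x"
  shows "AE x in M. P (a g x)"
proof (rule AE_distrD[where M' = M])
  show "a g \<in> measurable M M"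
    using nonsingular_actionD(2)[OF assms(1,2)] .
  show "AE x in distr M M (a g). P x"
    using absolutely_continuous_AE[OF _ nonsingular_actionD(3)[OF assms(1,2)] assms(3)] by simp
qed

lemma group_action_one:
  assumes "group_action G E a" "x \<in> E"
  shows "a \<one>\<^bsub>G\<^esub> x = x"
  using fun_cong[OF group_action.id_eq_one[OF assms(1)], of x] assms(2) by simp

lemma group_action_cancel:
  assumes "group G" "group_action G E a" "g \<in> carrier G" "x \<in> E"
  shows "a (inv\<^bsub>G\<^esub> g) (a g x) = x" "a g (a (inv\<^bsub>G\<^esub> g) x) = x"
proof -
  interpret group G by fact
  show "a (inv\<^bsub>G\<^esub> g) (a g x) = x" "a g (a (inv\<^bsub>G\<^esub> g) x) = x"
    using group_action.composition_rule[OF assms(2,4), of "inv\<^bsub>G\<^esub> g" g]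
      group_action.composition_rule[OF assms(2,4), of g "inv\<^bsub>G\<^esub> g"] assms(3)
      group_action_one[OF assms(2,4)] by simp_all
qed

text \<open>Suppose that \<open>U\<close> has positive measure and that its translates by \<open>g \<noteq> \<one>\<close> meet it in null sets. Then the
  translates of \<open>U\<close> are almost disjoint in a probability space, so their measures have sum at
  most \<open>1\<close>. By hypothesis they are at least \<open>(measure M U)\<^sup>2 * c g\<close>, so \<open>c\<close> would be summable.\<close>

lemma conservative_actionI:
  fixes c :: "'g \<Rightarrow> real"
  assumes "prob_space M" "group G" and ns: "nonsingular_action G M a"
    and c: "\<And>g. g \<in> carrier G \<Longrightarrow> 0 \<le> c g" "\<not> c summable_on carrier G"
    and lower: "\<And>g U. g \<in> carrier G \<Longrightarrow> U \<in> sets M \<Longrightarrow>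
      (measure M U)\<^sup>2 * c g \<le> measure (distr M M (a g)) U"
  shows "conservative_action G M a"
  unfolding conservative_action_def
proof (intro conjI ns ballI impI)
  interpret prob_space M by fact
  interpret G: group G by fact
  note ga = nonsingular_actionD(1)[OF ns] and meas = nonsingular_actionD(2)[OF ns]
  fix U assume U: "U \<in> sets M" "0 < emeasure M U"
  show "\<exists>g\<in>carrier G - {\<one>\<^bsub>G\<^esub>}. 0 < emeasure M (a g ` U \<inter> U)"
  proof (rule ccontr)
    assume "\<not> ?thesis"
    then have null: "emeasure M (a g ` U \<inter> U) = 0" if "g \<in> carrier G" "g \<noteq> \<one>\<^bsub>G\<^esub>" for g
      using that by (auto simp: not_less)
    \<comment> \<open>\<open>B g\<close> is the translate of \<open>U\<close> by the inverse of \<open>g\<close>.\<close>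
    define B where "B g = a g -` U \<inter> space M" for g
    have B [measurable]: "B g \<in> sets M" if "g \<in> carrier G" for g
      unfolding B_def using measurable_sets[OF meas[OF that] U(1)] .
    have mB: "measure (distr M M (a g)) U = measure M (B g)" if "g \<in> carrier G" for g
      unfolding B_def using meas[OF that] U(1) by (rule measure_distr)
    have disj: "AE x in M. \<not> (x \<in> B g \<and> x \<in> B h)" if gh: "g \<in> carrier G" "h \<in> carrier G" "g \<noteq> h" for g h
    proof -
      define k where "k = g \<otimes>\<^bsub>G\<^esub> inv\<^bsub>G\<^esub> h"
      have k: "k \<in> carrier G" "inv\<^bsub>G\<^esub> k \<noteq> \<one>\<^bsub>G\<^esub>" "k \<otimes>\<^bsub>G\<^esub> h = g"
      proof -
        show "k \<in> carrier G" "k \<otimes>\<^bsub>G\<^esub> h = g"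
          using gh by (auto simp: k_def G.m_assoc)
        then show "inv\<^bsub>G\<^esub> k \<noteq> \<one>\<^bsub>G\<^esub>"
          using gh G.inv_eq_1_iff by auto
      qed
      have eq: "a (inv\<^bsub>G\<^esub> k) ` U \<inter> U = U \<inter> B k"
      proof (intro equalityI subsetI)
        fix y assume "y \<in> a (inv\<^bsub>G\<^esub> k) ` U \<inter> U"
        then show "y \<in> U \<inter> B k"
          using group_action_cancel[OF assms(2) ga k(1)] sets.sets_into_space[OF U(1)]
          by (auto simp: B_def)
      next
        fix y assume y: "y \<in> U \<inter> B k"
        then have "y = a (inv\<^bsub>G\<^esub> k) (a k y)" "a k y \<in> U"
          using group_action_cancel[OF assms(2) ga k(1), of y] by (auto simp: B_def)
        then show "y \<in> a (inv\<^bsub>G\<^esub> k) ` U \<inter> U"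
          using y by blast
      qed
      have "AE y in M. y \<notin> U \<inter> B k"
      proof (rule AE_not_in)
        show "U \<inter> B k \<in> null_sets M"
          using null[OF G.inv_closed[OF k(1)] k(2)] U(1) B[OF k(1)] unfolding eq by auto
      qed
      then have "AE x in M. a h x \<notin> U \<inter> B k"
        by (rule AE_translate[OF ns gh(2)])
      then show ?thesis
      proof (rule AE_mp, intro AE_I2 impI notI)
        fix x assume x: "x \<in> space M" "a h x \<notin> U \<inter> B k" "x \<in> B g \<and> x \<in> B h"
        then have "a k (a h x) = a g x"
          using group_action.composition_rule[OF ga x(1) k(1) gh(2)] k(3) by simp
        moreover have "a h x \<in> space M"
          using measurable_space[OF meas[OF gh(2)] x(1)] .
        ultimately show False
          using x by (auto simp: B_def)
      qed
    qed
    have "(\<Sum>g\<in>K. measure M (B g)) \<le> 1" if K: "finite K" "K \<subseteq> carrier G" for K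
    proof -
      have [measurable]: "B g \<in> sets M" if "g \<in> K" for g
        using B K that by auto
      have "AE x in M. \<forall>g\<in>K. \<forall>h\<in>K. g \<noteq> h \<longrightarrow> \<not> (x \<in> B g \<and> x \<in> B h)"
      proof (intro AE_finite_allI K(1))
        fix g h assume gh: "g \<in> K" "h \<in> K"
        show "AE x in M. g \<noteq> h \<longrightarrow> \<not> (x \<in> B g \<and> x \<in> B h)"
        proof (cases "g = h")
          case False
          have "AE x in M. \<not> (x \<in> B g \<and> x \<in> B h)"
            using False gh K(2) by (intro disj) auto
          then show ?thesis
            by (rule eventually_mono) blast
        qed simp
      qed
      then have le: "AE x in M. (\<Sum>g\<in>K. indicator (B g) x) \<le> (1 :: real)"
      proof (rule AE_mp, intro AE_I2 impI)
        fix x assume *: "\<forall>g\<in>K. \<forall>h\<in>K. g \<noteq> h \<longrightarrow> \<not> (x \<in> B g \<and> x \<in> B h)"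
        have "(\<Sum>g\<in>K. indicator (B g) x) = real (card {g \<in> K. x \<in> B g})"
          using K(1) by (simp add: indicator_def of_bool_def sum.If_cases Int_def)
        also have "card {g \<in> K. x \<in> B g} \<le> 1"
          using * K(1) by (simp add: card_le_Suc0_iff_eq) blast
        finally show "(\<Sum>g\<in>K. indicator (B g) x) \<le> (1 :: real)"
          by simp
      qed
      have "(\<Sum>g\<in>K. measure M (B g)) = (\<Sum>g\<in>K. expectation (indicator (B g)))"
        using K B by (intro sum.cong refl) (auto simp: subset_eq)
      also have "\<dots> = expectation (\<lambda>x. \<Sum>g\<in>K. indicator (B g) x)"
        by (rule Bochner_Integration.integral_sum[symmetric]) (auto simp: less_top[symmetric])
      also have "\<dots> \<le> expectation (\<lambda>x. 1)"
        using le by (intro integral_mono_AE Bochner_Integration.integrable_sum) (auto simp: less_top[symmetric])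
      finally show ?thesis
        by (simp add: prob_space)
    qed
    note packing = this
    have "(\<Sum>g\<in>K. (measure M U)\<^sup>2 * c g) \<le> 1" if K: "finite K" "K \<subseteq> carrier G" for K
    proof -
      have "(\<Sum>g\<in>K. (measure M U)\<^sup>2 * c g) \<le> (\<Sum>g\<in>K. measure M (B g))"
      proof (rule sum_mono)
        fix g assume "g \<in> K"
        then have g: "g \<in> carrier G"
          using K(2) by blast
        show "(measure M U)\<^sup>2 * c g \<le> measure M (B g)"
          using lower[OF g U(1)] unfolding mB[OF g] .
      qed
      also have "\<dots> \<le> 1"
        by (rule packing[OF K])
      finally show ?thesis .
    qed
    then have "(\<lambda>g. (measure M U)\<^sup>2 * c g) summable_on carrier G"
      using c(1) by (intro nonneg_bdd_above_summable_on bdd_aboveI[of _ 1]) auto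
    then have "(\<lambda>g. inverse ((measure M U)\<^sup>2) * ((measure M U)\<^sup>2 * c g)) summable_on carrier G"
      by (rule summable_on_cmult_right)
    moreover have "measure M U \<noteq> 0"
      using U(2) by (simp add: emeasure_eq_measure)
    ultimately show False
      using c(2) by (simp add: field_simps)
  qed
qed

section \<open>Criteria for dissipativity\<close>

text \<open>Almost every orbit contains exactly one point where \<open>h\<close> is minimal: the minimum is attained
  because sublevel sets meet the orbit in finitely many group elements, and it is strict because
  \<open>h\<close> takes distinct values at distinct group elements. The set of these minimal points is a
  fundamental domain.\<close>

lemma dissipative_actionI:
  fixes h :: "'x \<Rightarrow> real"
  assumes "group G" and ns: "nonsingular_action G M a" and "countable (carrier G)"
    and [measurable]: "h \<in> borel_measurable M"
    and fin: "AE x in M. \<forall>t. finite {g \<in> carrier G. h (a g x) \<le> t}"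
    and inj: "\<And>g. g \<in> carrier G \<Longrightarrow> g \<noteq> \<one>\<^bsub>G\<^esub> \<Longrightarrow> AE x in M. h (a g x) \<noteq> h x"
  shows "dissipative_action G M a"
  unfolding dissipative_action_def
proof (intro conjI ns)
  interpret G: group G by fact
  note ga = nonsingular_actionD(1)[OF ns] and meas = nonsingular_actionD(2)[OF ns]
  have comp: "a g (a k x) = a (g \<otimes>\<^bsub>G\<^esub> k) x" if "g \<in> carrier G" "k \<in> carrier G" "x \<in> space M" for g k x
    using group_action.composition_rule[OF ga that(3,1,2)] by simp
  have cancel: "a (inv\<^bsub>G\<^esub> g) (a g x) = x" "a g (a (inv\<^bsub>G\<^esub> g) x) = x"
    if "g \<in> carrier G" "x \<in> space M" for g x
    using group_action_cancel[OF assms(1) ga that] by auto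
  have space: "a g x \<in> space M" if "g \<in> carrier G" "x \<in> space M" for g x
    using measurable_space[OF meas[OF that(1)] that(2)] .
  define U where "U = {x \<in> space M. \<forall>g\<in>carrier G - {\<one>\<^bsub>G\<^esub>}. h x < h (a g x)}"
  have U: "U \<in> sets M"
    unfolding U_def
  proof (rule sets.sets_Collect_countable_All')
    fix g assume "g \<in> carrier G - {\<one>\<^bsub>G\<^esub>}"
    then have [measurable]: "a g \<in> measurable M M"
      using meas by auto
    show "{x \<in> space M. h x < h (a g x)} \<in> sets M"
      by measurable
  qed (use assms(3) in auto)
  have "disjoint_family_on (\<lambda>g. a g ` U) (carrier G)"
    unfolding disjoint_family_on_def
  proof (intro ballI impI, rule ccontr)
    fix g k assume gk: "g \<in> carrier G" "k \<in> carrier G" "g \<noteq> k" and "a g ` U \<inter> a k ` U \<noteq> {}"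
    then obtain x y where xy: "x \<in> U" "y \<in> U" "a g x = a k y"
      by blast
    have less: "h x < h y" if xy: "x \<in> U" "y \<in> U" "a g x = a k y" and gk: "g \<in> carrier G" "k \<in> carrier G" "g \<noteq> k"
      for g k x y
    proof -
      have "y = a (inv\<^bsub>G\<^esub> k \<otimes>\<^bsub>G\<^esub> g) x"
        using xy gk cancel(1)[of k y] by (simp add: U_def flip: comp)
      moreover have "inv\<^bsub>G\<^esub> k \<otimes>\<^bsub>G\<^esub> g \<noteq> \<one>\<^bsub>G\<^esub>"
        using gk by (metis G.inv_closed G.inv_equality G.inv_inv)
      ultimately show ?thesis
        using xy(1) gk by (auto simp: U_def)
    qed
    show False
      using less[OF xy gk] less[OF xy(2,1) xy(3)[symmetric] gk(2,1)] gk(3) by auto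
  qed
  moreover have "space M - (\<Union>g\<in>carrier G. a g ` U) \<in> null_sets M"
  proof -
    have image: "a g ` U \<in> sets M" if "g \<in> carrier G" for g
    proof -
      have "a g ` U = a (inv\<^bsub>G\<^esub> g) -` U \<inter> space M"
      proof (intro equalityI subsetI)
        fix y assume "y \<in> a g ` U"
        then show "y \<in> a (inv\<^bsub>G\<^esub> g) -` U \<inter> space M"
          using cancel(1)[OF that] space[OF that] by (auto simp: U_def)
      next
        fix y assume "y \<in> a (inv\<^bsub>G\<^esub> g) -` U \<inter> space M"
        then show "y \<in> a g ` U"
          using cancel(2)[OF that, of y] by (intro image_eqI[of _ _ "a (inv\<^bsub>G\<^esub> g) y"]) auto
      qed
      then show ?thesis
        using measurable_sets[OF meas[OF G.inv_closed[OF that]] U] by simp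
    qed
    have "AE x in M. \<forall>k\<in>carrier G. \<forall>g\<in>carrier G. g \<noteq> \<one>\<^bsub>G\<^esub> \<longrightarrow> h (a g (a k x)) \<noteq> h (a k x)"
    proof (intro AE_ball_countable[THEN iffD2] ballI assms(3))
      fix k g assume kg: "k \<in> carrier G" "g \<in> carrier G"
      show "AE x in M. g \<noteq> \<one>\<^bsub>G\<^esub> \<longrightarrow> h (a g (a k x)) \<noteq> h (a k x)"
        using AE_translate[OF ns kg(1) inj[OF kg(2)]] by (cases "g = \<one>\<^bsub>G\<^esub>") auto
    qed
    with fin have "AE x in M. x \<notin> space M - (\<Union>g\<in>carrier G. a g ` U)"
    proof (eventually_elim, intro notI, elim DiffE)
      fix x assume fin: "\<forall>t. finite {g \<in> carrier G. h (a g x) \<le> t}"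
        and inj: "\<forall>k\<in>carrier G. \<forall>g\<in>carrier G. g \<noteq> \<one>\<^bsub>G\<^esub> \<longrightarrow> h (a g (a k x)) \<noteq> h (a k x)"
        and x: "x \<in> space M" "x \<notin> (\<Union>g\<in>carrier G. a g ` U)"
      define S where "S = {g \<in> carrier G. h (a g x) \<le> h (a \<one>\<^bsub>G\<^esub> x)}"
      have S: "finite S" "S \<noteq> {}"
        using fin by (auto simp: S_def)
      define k where "k = arg_min_on (\<lambda>g. h (a g x)) S"
      have kS: "k \<in> S" and least: "\<And>g. g \<in> S \<Longrightarrow> h (a k x) \<le> h (a g x)"
        using arg_min_if_finite(1)[OF S] arg_min_least[OF S] by (auto simp: k_def)
      have k: "k \<in> carrier G"
        using kS by (simp add: S_def)
      have min: "h (a k x) \<le> h (a g x)" if "g \<in> carrier G" for g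
        using least[of g] kS that by (cases "g \<in> S") (auto simp: S_def)
      have "a k x \<in> U"
        unfolding U_def
      proof (intro CollectI conjI ballI)
        show "a k x \<in> space M"
          by (rule space[OF k x(1)])
        fix g assume g: "g \<in> carrier G - {\<one>\<^bsub>G\<^esub>}"
        then have "h (a k x) \<le> h (a g (a k x))"
          using min[of "g \<otimes>\<^bsub>G\<^esub> k"] k x(1) by (simp add: comp)
        moreover have "h (a g (a k x)) \<noteq> h (a k x)"
          using inj g k by blast
        ultimately show "h (a k x) < h (a g (a k x))"
          by simp
      qed
      then have "x \<in> a (inv\<^bsub>G\<^esub> k) ` U"
        using cancel(1)[OF k x(1)] by (intro image_eqI[of _ _ "a k x"]) auto
      then show False
        using x(2) k by blast
    qed
    moreover have "space M - (\<Union>g\<in>carrier G. a g ` U) \<in> sets M"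
      using image assms(3) by (intro sets.Diff sets.top sets.countable_UN') auto
    ultimately show ?thesis
      using AE_iff_null_sets by blast
  qed
  ultimately show "\<exists>U\<in>sets M. disjoint_family_on (\<lambda>g. a g ` U) (carrier G) \<and>
      space M - (\<Union>g\<in>carrier G. a g ` U) \<in> null_sets M"
    using U by blast
qed

text \<open>The sum \<open>f\<close> of the \<open>\<surd>(w g)\<close> is integrable, hence almost everywhere finite. On the set
  \<open>B k\<close> where \<open>f \<le> k\<close> one has \<open>w g = \<surd>(w g) \<surd>(w g) \<le> k \<surd>(w g)\<close>, so the preimage of \<open>B k\<close>
  under \<open>a g\<close> has measure at most \<open>k * q g\<close>. By Borel-Cantelli almost every orbit visits each
  \<open>B k\<close> only finitely often, so the sublevel sets of \<open>f\<close> on orbits are finite. The bounded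
  function \<open>T\<close> breaks ties between points at which \<open>f\<close> agrees up to rounding.\<close>

lemma dissipative_action_of_summable_affinities:
  fixes w :: "'g \<Rightarrow> 'x \<Rightarrow> real" and q :: "'g \<Rightarrow> real" and T :: "'x \<Rightarrow> real"
  assumes "prob_space M" "group G" and ns: "nonsingular_action G M a"
    and cnt: "countable (carrier G)" "infinite (carrier G)"
    and w: "\<And>g. g \<in> carrier G \<Longrightarrow> w g \<in> borel_measurable M" "\<And>g x. 0 \<le> w g x"
    and dens: "\<And>g. g \<in> carrier G \<Longrightarrow> distr M M (a g) = density M (w g)"
    and q: "\<And>g. g \<in> carrier G \<Longrightarrow> (\<integral>\<^sup>+x. ennreal (sqrt (w g x)) \<partial>M) \<le> ennreal (q g)"
      "\<And>g. g \<in> carrier G \<Longrightarrow> 0 \<le> q g" "q summable_on carrier G"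
    and T: "T \<in> borel_measurable M" "\<And>x. 0 \<le> T x" "\<And>x. T x < 1"
      "\<And>g. g \<in> carrier G \<Longrightarrow> g \<noteq> \<one>\<^bsub>G\<^esub> \<Longrightarrow> AE x in M. T (a g x) \<noteq> T x"
  shows "dissipative_action G M a"
proof -
  interpret prob_space M by fact
  note meas = nonsingular_actionD(2)[OF ns]
  define e where "e = from_nat_into (carrier G)"
  have e: "bij_betw e UNIV (carrier G)"
    unfolding e_def by (rule bij_betw_from_nat_into[OF cnt])
  then have eG [simp]: "e n \<in> carrier G" for n
    by (auto simp: bij_betw_def)
  have [measurable]: "w (e n) \<in> borel_measurable M" for n
    by (rule w(1)) simp
  have sumq: "summable (\<lambda>n. q (e n))"
    using q(3) by (intro summable_on_imp_summable) (simp add: summable_on_reindex_bij_betw[OF e])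
  define S where "S x = (\<Sum>n. ennreal (sqrt (w (e n) x)))" for x
  have S [measurable]: "S \<in> borel_measurable M"
    unfolding S_def by measurable
  have "(\<integral>\<^sup>+x. S x \<partial>M) = (\<Sum>n. \<integral>\<^sup>+x. ennreal (sqrt (w (e n) x)) \<partial>M)"
    unfolding S_def by (rule nn_integral_suminf) measurable
  also have "\<dots> \<le> (\<Sum>n. ennreal (q (e n)))"
    by (intro suminf_le q(1)) auto
  also have "\<dots> = ennreal (\<Sum>n. q (e n))"
    using q(2) sumq by (intro suminf_ennreal2) auto
  finally have "(\<integral>\<^sup>+x. S x \<partial>M) \<noteq> \<infinity>"
    by (auto simp: top_unique)
  then have Sfin: "AE x in M. S x \<noteq> \<infinity>"
    by (intro nn_integral_PInf_AE) auto
  \<comment> \<open>Where \<open>S\<close> is infinite, \<open>f\<close> has the default value \<open>0\<close>; this happens on a null set only.\<close>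
  define f where "f x = enn2real (S x)" for x
  have [measurable]: "f \<in> borel_measurable M"
    unfolding f_def by measurable
  have wf: "AE x in M. w (e n) x \<le> f x * sqrt (w (e n) x)" for n
    using Sfin
  proof eventually_elim
    case (elim x)
    have "ennreal (sqrt (w (e n) x)) \<le> S x"
      unfolding S_def using sum_le_suminf[of "\<lambda>n. ennreal (sqrt (w (e n) x))" "{n}"] by simp
    then have "sqrt (w (e n) x) \<le> f x"
      unfolding f_def using elim w(2)[of "e n" x]
      by (metis enn2real_ennreal enn2real_mono ennreal_less_top infinity_ennreal_def real_sqrt_ge_zero top.not_eq_extremum)
    then have "sqrt (w (e n) x) * sqrt (w (e n) x) \<le> f x * sqrt (w (e n) x)"
      using w(2) by (intro mult_right_mono) auto
    then show ?case
      using w(2) by simp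
  qed
  define B where "B k = {x \<in> space M. f x \<le> real k}" for k :: nat
  have B [measurable]: "B k \<in> sets M" for k
    unfolding B_def by measurable
  have bound: "measure M (a (e n) -` B k \<inter> space M) \<le> real k * q (e n)" for n k
  proof -
    have "emeasure M (a (e n) -` B k \<inter> space M) = emeasure (distr M M (a (e n))) (B k)"
      by (rule emeasure_distr[OF meas B, symmetric]) simp
    also have "\<dots> = (\<integral>\<^sup>+x. ennreal (w (e n) x) * indicator (B k) x \<partial>M)"
      by (simp add: dens emeasure_density)
    also have "\<dots> \<le> (\<integral>\<^sup>+x. ennreal (real k) * ennreal (sqrt (w (e n) x)) \<partial>M)"
    proof (rule nn_integral_mono_AE)
      show "AE x in M. ennreal (w (e n) x) * indicator (B k) x \<le> ennreal (real k) * ennreal (sqrt (w (e n) x))"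
        using wf[of n]
      proof eventually_elim
        case (elim x)
        show ?case
        proof (cases "x \<in> B k")
          case True
          then have "f x * sqrt (w (e n) x) \<le> real k * sqrt (w (e n) x)"
            using w(2) by (intro mult_right_mono) (auto simp: B_def)
          then show ?thesis
            using elim True by (simp add: ennreal_leI flip: ennreal_mult')
        qed simp
      qed
    qed
    also have "\<dots> = ennreal (real k) * (\<integral>\<^sup>+x. ennreal (sqrt (w (e n) x)) \<partial>M)"
      by (rule nn_integral_cmult) measurable
    also have "\<dots> \<le> ennreal (real k) * ennreal (q (e n))"
      by (intro mult_left_mono q(1)) auto
    also have "\<dots> = ennreal (real k * q (e n))"
      by (simp add: ennreal_mult')
    finally show ?thesis
      using q(2)[OF eG[of n]] by (simp add: emeasure_eq_measure)
  qed
  have visits: "AE x in M. \<forall>k. finite {g \<in> carrier G. a g x \<in> B k}"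
    unfolding AE_all_countable
  proof
    fix k
    have "AE x in M. eventually (\<lambda>n. x \<in> space M - (a (e n) -` B k \<inter> space M)) sequentially"
    proof (rule borel_cantelli_AE1)
      show "a (e n) -` B k \<inter> space M \<in> sets M" for n
        by (rule measurable_sets[OF meas B]) simp
      show "summable (\<lambda>n. measure M (a (e n) -` B k \<inter> space M))"
        by (rule summable_comparison_test'[OF summable_mult[OF sumq, of "real k"]])
          (use bound in auto)
    qed (simp add: less_top[symmetric])
    then show "AE x in M. finite {g \<in> carrier G. a g x \<in> B k}"
    proof (rule AE_mp, intro AE_I2 impI)
      fix x assume "eventually (\<lambda>n. x \<in> space M - (a (e n) -` B k \<inter> space M)) sequentially"
      then obtain N where N: "x \<in> space M - (a (e n) -` B k \<inter> space M)" if "n \<ge> N" for n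
        by (auto simp: eventually_sequentially)
      have "{g \<in> carrier G. a g x \<in> B k} \<subseteq> e ` {..<N}"
      proof
        fix g assume g: "g \<in> {g \<in> carrier G. a g x \<in> B k}"
        then obtain n where n: "g = e n"
          using e by (auto simp: bij_betw_def)
        then have "n < N"
          using N[of n] g by (cases "n < N") auto
        then show "g \<in> e ` {..<N}"
          using n by auto
      qed
      then show "finite {g \<in> carrier G. a g x \<in> B k}"
        by (rule finite_subset) simp
    qed
  qed
  \<comment> \<open>As \<open>T\<close> has values in \<open>[0, 1)\<close>, both summands can be recovered from \<open>h\<close>.\<close>
  define h where "h x = real_of_int \<lceil>f x\<rceil> + T x" for x
  show ?thesis
  proof (rule dissipative_actionI[OF assms(2) ns cnt(1)])
    note [measurable] = T(1)
    show "h \<in> borel_measurable M"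
      unfolding h_def by measurable
    show "AE x in M. \<forall>t. finite {g \<in> carrier G. h (a g x) \<le> t}"
      using visits
    proof (rule AE_mp, intro AE_I2 impI allI)
      fix x t assume x: "x \<in> space M" and fin: "\<forall>k. finite {g \<in> carrier G. a g x \<in> B k}"
      have "{g \<in> carrier G. h (a g x) \<le> t} \<subseteq> {g \<in> carrier G. a g x \<in> B (nat \<lceil>t\<rceil>)}"
      proof clarsimp
        fix g assume g: "g \<in> carrier G" "h (a g x) \<le> t"
        have "f (a g x) \<le> t"
          using g(2) T(2)[of "a g x"] le_of_int_ceiling[of "f (a g x)"] unfolding h_def by linarith
        also have "t \<le> real (nat \<lceil>t\<rceil>)"
          by linarith
        finally show "a g x \<in> B (nat \<lceil>t\<rceil>)"
          using measurable_space[OF meas[OF g(1)] x] by (simp add: B_def)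
      qed
      then show "finite {g \<in> carrier G. h (a g x) \<le> t}"
        by (rule finite_subset) (use fin in blast)
    qed
    fix g assume "g \<in> carrier G" "g \<noteq> \<one>\<^bsub>G\<^esub>"
    then show "AE x in M. h (a g x) \<noteq> h x"
    proof (rule AE_mp[OF T(4)], intro AE_I2 impI notI)
      fix x assume "T (a g x) \<noteq> T x" "h (a g x) = h x"
      moreover have "\<lfloor>h y\<rfloor> = \<lceil>f y\<rceil>" for y
        unfolding h_def using T(2,3)[of y] by (intro floor_unique) auto
      ultimately show False
        by (metis add_left_cancel h_def)
    qed
  qed
qed

section \<open>Essential freeness of the Bernoulli action\<close>

text \<open>Base \<open>3\<close> is used because base \<open>2\<close> would identify digit sequences such as \<open>0111\<dots>\<close> and
  \<open>1000\<dots>\<close>. With digits \<open>0\<close> and \<open>1\<close> only, the values lie in \<open>[0, 1/2]\<close>, so the first digit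
  can be read off: it is \<open>1\<close> if and only if the value is at least \<open>1/3\<close>.\<close>

definition ternary_value :: "(nat \<Rightarrow> bool) \<Rightarrow> real" where
  "ternary_value u = (\<Sum>n. of_bool (u n) * (1 / 3) ^ Suc n)"

lemma ternary_value_summable: "summable (\<lambda>n. of_bool (u n) * (1 / 3 :: real) ^ Suc n)"
proof (rule summable_comparison_test'[where N = 0])
  show "summable (\<lambda>n. (1 / 3 :: real) ^ Suc n)"
    using summable_mult[OF summable_geometric[of "1 / 3 :: real"], of "1 / 3"] by simp
  show "norm (of_bool (u n) * (1 / 3 :: real) ^ Suc n) \<le> (1 / 3) ^ Suc n" for n
    by (cases "u n") simp_all
qed

lemma ternary_value_bounds: "0 \<le> ternary_value u" "ternary_value u \<le> 1 / 2"
proof -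
  show "0 \<le> ternary_value u"
    unfolding ternary_value_def by (intro suminf_nonneg ternary_value_summable) simp
  have sums: "(\<lambda>n. (1 / 3 :: real) ^ Suc n) sums (1 / 2)"
    using sums_mult[OF geometric_sums[of "1 / 3 :: real"], of "1 / 3"] by simp
  have "ternary_value u \<le> (\<Sum>n. (1 / 3) ^ Suc n)"
    unfolding ternary_value_def using sums
    by (intro suminf_le ternary_value_summable) (auto simp: of_bool_def sums_iff)
  then show "ternary_value u \<le> 1 / 2"
    using sums by (simp add: sums_iff)
qed

lemma ternary_value_head: "3 * ternary_value u = of_bool (u 0) + ternary_value (\<lambda>n. u (Suc n))"
proof -
  have "ternary_value u = of_bool (u 0) / 3 + (\<Sum>n. of_bool (u (Suc n)) * (1 / 3) ^ Suc (Suc n))"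
    using suminf_split_head[OF ternary_value_summable[of u]] by (simp add: ternary_value_def)
  also have "(\<Sum>n. of_bool (u (Suc n)) * (1 / 3 :: real) ^ Suc (Suc n))
      = (\<Sum>n. 1 / 3 * (of_bool (u (Suc n)) * (1 / 3) ^ Suc n))"
    by (intro suminf_cong) simp
  also have "\<dots> = 1 / 3 * ternary_value (\<lambda>n. u (Suc n))"
    unfolding ternary_value_def by (rule suminf_mult[OF ternary_value_summable])
  finally show ?thesis
    by simp
qed

lemma ternary_value_inject:
  assumes "ternary_value u = ternary_value v"
  shows "u = v"
proof
  fix n
  show "u n = v n"
    using assms
  proof (induction n arbitrary: u v)
    case 0
    then show ?case
      using ternary_value_head[of u] ternary_value_head[of v]
        ternary_value_bounds[of "\<lambda>n. u (Suc n)"] ternary_value_bounds[of "\<lambda>n. v (Suc n)"]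
      by (cases "u 0"; cases "v 0") simp_all
  next
    case (Suc n)
    have "u 0 = v 0"
      using Suc.prems ternary_value_head[of u] ternary_value_head[of v]
        ternary_value_bounds[of "\<lambda>n. u (Suc n)"] ternary_value_bounds[of "\<lambda>n. v (Suc n)"]
      by (cases "u 0"; cases "v 0") simp_all
    then have "ternary_value (\<lambda>n. u (Suc n)) = ternary_value (\<lambda>n. v (Suc n))"
      using Suc.prems ternary_value_head[of u] ternary_value_head[of v] by simp
    then show ?case
      by (rule Suc.IH)
  qed
qed

text \<open>Such sets give arbitrarily many disjoint pairs \<open>{i, \<psi> i}\<close>, and so independent events.\<close>

lemma exists_finite_disjoint_from_image:
  assumes "infinite I" "inj_on \<psi> I" "\<psi> \<in> I \<rightarrow> I" "\<And>i. i \<in> I \<Longrightarrow> \<psi> i \<noteq> i"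
  shows "\<exists>J\<subseteq>I. finite J \<and> card J = n \<and> J \<inter> \<psi> ` J = {}"
proof (induction n)
  case 0
  show ?case by (intro exI[of _ "{}"]) simp
next
  case (Suc n)
  then obtain J where J: "J \<subseteq> I" "finite J" "card J = n" "J \<inter> \<psi> ` J = {}"
    by blast
  have "finite (J \<union> \<psi> ` J \<union> (\<psi> -` J \<inter> I))"
    using J assms(2) by (intro finite_UnI finite_imageI finite_vimage_IntI) auto
  then have "infinite (I - (J \<union> \<psi> ` J \<union> (\<psi> -` J \<inter> I)))"
    using assms(1) by simp
  then obtain i where "i \<in> I - (J \<union> \<psi> ` J \<union> (\<psi> -` J \<inter> I))"
    using infinite_imp_nonempty by blast
  then have i: "i \<in> I" "i \<notin> J" "i \<notin> \<psi> ` J" "\<psi> i \<notin> J"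
    by auto
  show ?case
    using J i assms(4)[OF i(1)] by (intro exI[of _ "insert i J"]) auto
qed

text \<open>The pairs \<open>{j, \<psi> j}\<close> are disjoint, so the coincidences are independent. Each has probability
  \<open>F j * F (\<psi> j) + (1 - F j) (1 - F (\<psi> j))\<close>, a convex combination of \<open>F (\<psi> j)\<close> and
  \<open>1 - F (\<psi> j)\<close>, which are both at most \<open>1 - \<delta>\<close>.\<close>

lemma bernoulli_coincidence_le:
  fixes F :: "'i \<Rightarrow> real"
  assumes F: "\<And>i. i \<in> I \<Longrightarrow> F i \<in> {0<..<1}" "\<And>i. i \<in> I \<Longrightarrow> \<delta> \<le> F i \<and> F i \<le> 1 - \<delta>"
    and J: "finite J" "J \<subseteq> I" "\<psi> ` J \<subseteq> I" "inj_on \<psi> J" "J \<inter> \<psi> ` J = {}"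
    and A: "A \<subseteq> {x \<in> I \<rightarrow>\<^sub>E UNIV. \<forall>j\<in>J. x (\<psi> j) = x j}"
  shows "measure (bernoulli_space I F) A \<le> (1 - \<delta>) ^ card J"
proof -
  let ?K = "J \<union> \<psi> ` J" and ?p = "\<lambda>i b. pmf (bernoulli_pmf (1 - F i)) b"
  define S where "S = {s \<in> ?K \<rightarrow>\<^sub>E UNIV. \<forall>j\<in>J. s (\<psi> j) = (s j :: bool)}"
  define f where "f t = (\<Prod>j\<in>J. ?p j (t j) * ?p (\<psi> j) (t j))" for t
  interpret prob_space "bernoulli_space I F" by (rule prob_space_bernoulli_space)
  have K: "finite ?K" "?K \<subseteq> I" "S \<subseteq> ?K \<rightarrow>\<^sub>E UNIV"
    using J by (auto simp: S_def)
  have FJ: "F j \<in> {0<..<1}" "F (\<psi> j) \<in> {0<..<1}" "\<delta> \<le> F (\<psi> j)" "F (\<psi> j) \<le> 1 - \<delta>" if "j \<in> J" for j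
  proof -
    have "j \<in> I" "\<psi> j \<in> I"
      using that J(2,3) by auto
    then show "F j \<in> {0<..<1}" "F (\<psi> j) \<in> {0<..<1}" "\<delta> \<le> F (\<psi> j)" "F (\<psi> j) \<le> 1 - \<delta>"
      using F by auto
  qed
  \<comment> \<open>A pattern in \<open>S\<close> is determined by its values on \<open>J\<close>, so the sum over \<open>S\<close> is at most a
    sum over all patterns on \<open>J\<close>.\<close>
  have inj: "inj_on (\<lambda>s. restrict s J) S"
  proof (rule inj_onI)
    fix s t assume st: "s \<in> S" "t \<in> S" "restrict s J = restrict t J"
    then have eq: "s j = t j" if "j \<in> J" for j
      using that by (metis restrict_apply')
    show "s = t"
    proof (rule PiE_ext)
      show "s \<in> ?K \<rightarrow>\<^sub>E UNIV" "t \<in> ?K \<rightarrow>\<^sub>E UNIV"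
        using st by (auto simp: S_def)
      fix k assume "k \<in> ?K"
      then show "s k = t k"
        using eq st by (auto simp: S_def)
    qed
  qed
  have "A \<subseteq> cylinder I ?K S"
  proof
    fix x assume "x \<in> A"
    then have x: "x \<in> I \<rightarrow>\<^sub>E UNIV" "\<forall>j\<in>J. x (\<psi> j) = x j"
      using A by auto
    have "restrict x ?K \<in> S"
      unfolding S_def using x(2) by auto
    then show "x \<in> cylinder I ?K S"
      using x(1) by (simp add: cylinder_def)
  qed
  then have "measure (bernoulli_space I F) A \<le> measure (bernoulli_space I F) (cylinder I ?K S)"
    using measure_cylinder(1)[OF K] by (intro finite_measure_mono)
  also have "\<dots> = (\<Sum>s\<in>S. \<Prod>k\<in>?K. ?p k (s k))"
    by (rule measure_cylinder(2)[OF K])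
  also have "\<dots> = (\<Sum>s\<in>S. f (restrict s J))"
  proof (rule sum.cong[OF refl])
    fix s assume s: "s \<in> S"
    have "(\<Prod>k\<in>?K. ?p k (s k)) = (\<Prod>j\<in>J. ?p j (s j)) * (\<Prod>j\<in>J. ?p (\<psi> j) (s (\<psi> j)))"
      using J by (simp add: prod.union_disjoint prod.reindex)
    also have "\<dots> = f (restrict s J)"
      using s by (simp add: f_def S_def prod.distrib)
    finally show "(\<Prod>k\<in>?K. ?p k (s k)) = f (restrict s J)" .
  qed
  also have "\<dots> = (\<Sum>t\<in>(\<lambda>s. restrict s J) ` S. f t)"
    using sum.reindex[OF inj, of f] by simp
  also have "\<dots> \<le> (\<Sum>t\<in>J \<rightarrow>\<^sub>E UNIV. f t)"
  proof (rule sum_mono2)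
    show "finite (J \<rightarrow>\<^sub>E (UNIV :: bool set))"
      by (rule finite_PiE[OF J(1)]) simp
    show "(\<lambda>s. restrict s J) ` S \<subseteq> J \<rightarrow>\<^sub>E UNIV"
      by (auto simp: restrict_PiE_iff)
    show "0 \<le> f t" for t
      unfolding f_def by (intro prod_nonneg) simp
  qed
  also have "\<dots> = (\<Prod>j\<in>J. ?p j False * ?p (\<psi> j) False + ?p j True * ?p (\<psi> j) True)"
    unfolding f_def by (rule sum_PiE_prod_bool[OF J(1)])
  also have "\<dots> \<le> (\<Prod>j\<in>J. 1 - \<delta>)"
  proof (intro prod_mono conjI)
    fix j assume j: "j \<in> J"
    show "0 \<le> ?p j False * ?p (\<psi> j) False + ?p j True * ?p (\<psi> j) True"
      by simp
    have "F j * F (\<psi> j) + (1 - F j) * (1 - F (\<psi> j)) \<le> F j * (1 - \<delta>) + (1 - F j) * (1 - \<delta>)"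
      using FJ[OF j] by (intro add_mono mult_left_mono) auto
    also have "\<dots> = 1 - \<delta>"
      by (simp add: algebra_simps)
    finally show "?p j False * ?p (\<psi> j) False + ?p j True * ?p (\<psi> j) True \<le> 1 - \<delta>"
      using FJ[OF j] by simp
  qed
  finally show ?thesis
    by simp
qed

text \<open>A fixed point of \<open>g\<close> takes equal values at \<open>i\<close> and at its translate, for every \<open>i\<close>; this
  imposes coincidences on arbitrarily many disjoint pairs of coordinates.\<close>

lemma AE_bernoulli_action_not_fixed:
  fixes F :: "'i \<Rightarrow> real"
  assumes G: "group G" and free: "free_action G I \<phi>" and "infinite I" "countable I" "0 < \<delta>"
    and F: "\<And>i. i \<in> I \<Longrightarrow> F i \<in> {0<..<1}" "\<And>i. i \<in> I \<Longrightarrow> \<delta> \<le> F i \<and> F i \<le> 1 - \<delta>"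
    and g: "g \<in> carrier G" "g \<noteq> \<one>\<^bsub>G\<^esub>"
  shows "AE x in bernoulli_space I F. bernoulli_action G I \<phi> g x \<noteq> x"
proof -
  interpret G: group G by fact
  interpret A: group_action G I \<phi> using free by (simp add: free_action_def)
  let ?M = "bernoulli_space I F"
  interpret prob_space ?M by (rule prob_space_bernoulli_space)
  define \<psi> where "\<psi> = \<phi> (inv\<^bsub>G\<^esub> g)"
  have "inv\<^bsub>G\<^esub> g \<noteq> \<one>\<^bsub>G\<^esub>"
    using g by simp
  then have \<psi>: "inj_on \<psi> I" "\<psi> \<in> I \<rightarrow> I" "\<And>i. i \<in> I \<Longrightarrow> \<psi> i \<noteq> i"
    using g free unfolding \<psi>_def by (auto simp: free_action_def intro: A.inj_prop A.element_image)
  define E where "E = {x \<in> space ?M. \<forall>i\<in>I. x (\<psi> i) = x i}"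
  have E: "E \<in> sets ?M"
    unfolding E_def
  proof (rule sets.sets_Collect_countable_All'[OF _ assms(4)])
    fix i assume "i \<in> I"
    then have [measurable]: "(\<lambda>x. x i) \<in> measurable ?M (count_space UNIV)"
      "(\<lambda>x. x (\<psi> i)) \<in> measurable ?M (count_space UNIV)"
      using \<psi>(2) by (auto intro: measurable_coordinate)
    show "{x \<in> space ?M. x (\<psi> i) = x i} \<in> sets ?M"
      by measurable
  qed
  have le: "measure ?M E \<le> (1 - \<delta>) ^ n" for n
  proof -
    obtain J where J: "J \<subseteq> I" "finite J" "card J = n" "J \<inter> \<psi> ` J = {}"
      using exists_finite_disjoint_from_image[OF assms(3) \<psi>] by blast
    have "measure ?M E \<le> (1 - \<delta>) ^ card J"
    proof (rule bernoulli_coincidence_le[OF F])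
      show "inj_on \<psi> J" "\<psi> ` J \<subseteq> I"
        using \<psi> J(1) by (auto intro: inj_on_subset)
      show "E \<subseteq> {x \<in> I \<rightarrow>\<^sub>E UNIV. \<forall>j\<in>J. x (\<psi> j) = x j}"
        using J(1) by (auto simp: E_def)
    qed (use J in auto)
    then show ?thesis
      by (simp add: J(3))
  qed
  obtain i where "i \<in> I"
    using assms(3) by (metis all_not_in_conv finite.emptyI)
  then have \<delta>1: "1 - \<delta> > 0"
    using F[of i] by auto
  have "(\<lambda>n. (1 - \<delta>) ^ n) \<longlonglongrightarrow> 0"
    using \<delta>1 assms(5) by (intro LIMSEQ_realpow_zero) auto
  then have "measure ?M E \<le> 0"
    by (rule LIMSEQ_le_const) (use le in blast)
  then have "E \<in> null_sets ?M"
    using E by (simp add: emeasure_eq_measure measure_le_0_iff null_setsI)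
  then show ?thesis
  proof (rule AE_I')
    show "{x \<in> space ?M. \<not> bernoulli_action G I \<phi> g x \<noteq> x} \<subseteq> E"
    proof
      fix x assume "x \<in> {x \<in> space ?M. \<not> bernoulli_action G I \<phi> g x \<noteq> x}"
      then have x: "x \<in> space ?M" "bernoulli_action G I \<phi> g x = x"
        by auto
      then have "(\<lambda>i\<in>I. x (\<psi> i)) = x"
        by (simp add: bernoulli_action_def \<psi>_def)
      then have "x (\<psi> i) = x i" if "i \<in> I" for i
        using that by (metis restrict_apply')
      then show "x \<in> E"
        using x(1) by (simp add: E_def)
    qed
  qed
qed

text \<open>Almost every orbit consists of distinct points, so an injective function breaks ties on it.\<close>

lemma bernoulli_space_separating_function:
  fixes F :: "'i \<Rightarrow> real"
  assumes "countable I" "infinite I"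
  obtains T :: "('i \<Rightarrow> bool) \<Rightarrow> real" where "T \<in> borel_measurable (bernoulli_space I F)"
    "\<And>x. 0 \<le> T x" "\<And>x. T x < 1" "inj_on T (space (bernoulli_space I F))"
proof
  define T :: "('i \<Rightarrow> bool) \<Rightarrow> real" where "T x = ternary_value (\<lambda>n. x (from_nat_into I n))" for x
  have I: "bij_betw (from_nat_into I) UNIV I"
    by (rule bij_betw_from_nat_into[OF assms])
  have [measurable]: "(\<lambda>x. x (from_nat_into I n)) \<in> measurable (bernoulli_space I F) (count_space UNIV)" for n
    using I by (intro measurable_coordinate) (auto simp: bij_betw_def)
  show "T \<in> borel_measurable (bernoulli_space I F)"
    unfolding T_def ternary_value_def by measurable
  show "0 \<le> T x" "T x < 1" for x
    using ternary_value_bounds[of "\<lambda>n. x (from_nat_into I n)"] by (simp_all add: T_def)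
  show "inj_on T (space (bernoulli_space I F))"
  proof (rule inj_onI)
    fix x y assume xy: "x \<in> space (bernoulli_space I F)" "y \<in> space (bernoulli_space I F)" "T x = T y"
    then have *: "(\<lambda>n. x (from_nat_into I n)) = (\<lambda>n. y (from_nat_into I n))"
      unfolding T_def by (rule_tac ternary_value_inject)
    show "x = y"
    proof (rule PiE_ext)
      show "x \<in> I \<rightarrow>\<^sub>E UNIV" "y \<in> I \<rightarrow>\<^sub>E UNIV"
        using xy by simp_all
      fix i assume "i \<in> I"
      then obtain n where "i = from_nat_into I n"
        using I by (auto simp: bij_betw_def)
      then show "x i = y i"
        using fun_cong[OF *, of n] by simp
    qed
  qed
qed

section \<open>Conservative and dissipative Bernoulli actions\<close>

theorem proposition4p1:
  fixes G :: "('g, 'm) monoid_scheme" and I :: "'i set"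
    and \<phi> :: "'g \<Rightarrow> 'i \<Rightarrow> 'i" and \<delta> :: real and F :: "'i \<Rightarrow> real"
  assumes "group G" and "countable (carrier G)" and "infinite (carrier G)"
    and "countable I"
    and "free_action G I \<phi>"
    and "\<delta> > 0"
    and "\<And>i. i \<in> I \<Longrightarrow> F i \<in> {0<..<1}"
    and "\<And>i. i \<in> I \<Longrightarrow> \<delta> \<le> F i \<and> F i \<le> 1 - \<delta>"
    and "\<And>g. g \<in> carrier G \<Longrightarrow> (\<lambda>i. (F (\<phi> g i) - F i)\<^sup>2) summable_on I"
  shows
    "((\<exists>\<kappa>::real. \<kappa> > 1 / \<delta>\<^sup>2 + 1 / (\<delta> * (1 - \<delta>)\<^sup>2) \<and>
        \<not> (\<lambda>g. exp (- \<kappa> * (ell2_norm I (bernoulli_cocycle G \<phi> F g))\<^sup>2)) summable_on carrier G)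
      \<longrightarrow> conservative_action G (bernoulli_space I F) (bernoulli_action G I \<phi>))
     \<and>
     ((\<lambda>g. exp (- (1 / 2) * (ell2_norm I (bernoulli_cocycle G \<phi> F g))\<^sup>2)) summable_on carrier G
      \<longrightarrow> dissipative_action G (bernoulli_space I F) (bernoulli_action G I \<phi>))
     \<and>
     ((\<forall>i\<in>I. 1 / 3 \<le> F i \<and> F i \<le> 2 / 3) \<and>
      \<not> (\<lambda>g. exp (- 16 * (ell2_norm I (bernoulli_cocycle G \<phi> F g))\<^sup>2)) summable_on carrier G
      \<longrightarrow> conservative_action G (bernoulli_space I F) (bernoulli_action G I \<phi>))"
proof -
  interpret G: group G by fact
  have ga: "group_action G I \<phi>"
    using assms(5) by (simp add: free_action_def)
  interpret A: group_action G I \<phi> by fact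
  let ?M = "bernoulli_space I F" and ?T = "bernoulli_action G I \<phi>"
  let ?D = "\<lambda>g. (ell2_norm I (bernoulli_cocycle G \<phi> F g))\<^sup>2"
  interpret M: prob_space ?M by (rule prob_space_bernoulli_space)
  define F' where "F' g i = F (\<phi> (inv\<^bsub>G\<^esub> g) i)" for g i
  have D: "?D g = (\<Sum>\<^sub>\<infinity>i\<in>I. (F i - F' g i)\<^sup>2)" for g
    by (simp add: ell2_norm_square bernoulli_cocycle_def F'_def)
  have D0: "0 \<le> ?D g" for g
    by (rule zero_le_power2)
  have sum: "(\<lambda>i. (F i - F' g i)\<^sup>2) summable_on I" if "g \<in> carrier G" for g
    using bernoulli_cocycle_square_summable[OF assms(1) that assms(9)]
    by (simp add: bernoulli_cocycle_def F'_def)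
  have distr: "distr ?M ?M (?T g) = bernoulli_space I (F' g)" if "g \<in> carrier G" for g
    using distr_bernoulli_action(2)[OF assms(1) ga that] by (simp add: F'_def[abs_def])
  have closed: "\<phi> (inv\<^bsub>G\<^esub> g) i \<in> I" if "g \<in> carrier G" "i \<in> I" for g i
    using that A.element_image[of "inv\<^bsub>G\<^esub> g" i] by simp
  have ns: "nonsingular_action G ?M ?T"
    by (rule nonsingular_bernoulli_action[OF assms(1) ga assms(6)])
      (use assms(8) sum in \<open>auto simp: F'_def\<close>)
  have conservative: "conservative_action G ?M ?T"
    if \<epsilon>: "0 < \<epsilon>" "\<And>i. i \<in> I \<Longrightarrow> \<epsilon> \<le> F i \<and> F i \<le> 1 - \<epsilon>"
      and \<kappa>: "1 / \<epsilon>\<^sup>2 \<le> \<kappa>" "\<not> (\<lambda>g. exp (- \<kappa> * ?D g)) summable_on carrier G" for \<epsilon> \<kappa> :: real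
  proof (rule conservative_actionI[OF M.prob_space_axioms assms(1) ns])
    show "0 \<le> exp (- ?D g / \<epsilon>\<^sup>2)" for g
      by simp
    have le: "exp (- \<kappa> * ?D g) \<le> exp (- ?D g / \<epsilon>\<^sup>2)" for g
      using mult_right_mono[OF \<kappa>(1) D0[of g]] by simp
    show "\<not> (\<lambda>g. exp (- ?D g / \<epsilon>\<^sup>2)) summable_on carrier G"
    proof
      assume "(\<lambda>g. exp (- ?D g / \<epsilon>\<^sup>2)) summable_on carrier G"
      then have "(\<lambda>g. exp (- \<kappa> * ?D g)) summable_on carrier G"
        by (rule summable_on_comparison_test) (rule le, simp)
      then show False
        using \<kappa>(2) by contradiction
    qed
    fix g U assume g: "g \<in> carrier G" and U: "U \<in> sets ?M"
    have "(measure ?M U)\<^sup>2 \<le> measure (bernoulli_space I (F' g)) U * exp (?D g / \<epsilon>\<^sup>2)"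
      unfolding D
    proof (rule bernoulli_measure_square_le[OF \<epsilon>(1) _ _ sum[OF g] U])
      show "F i \<in> {\<epsilon>..1 - \<epsilon>}" "F' g i \<in> {\<epsilon>..1 - \<epsilon>}" if "i \<in> I" for i
        using \<epsilon>(2)[OF that] \<epsilon>(2)[OF closed[OF g that]] by (auto simp: F'_def)
    qed
    then show "(measure ?M U)\<^sup>2 * exp (- ?D g / \<epsilon>\<^sup>2) \<le> measure (distr ?M ?M (?T g)) U"
      unfolding distr[OF g] by (simp add: exp_minus field_simps)
  qed
  have part1: "conservative_action G ?M ?T"
    if "1 / \<delta>\<^sup>2 + 1 / (\<delta> * (1 - \<delta>)\<^sup>2) < \<kappa>" "\<not> (\<lambda>g. exp (- \<kappa> * ?D g)) summable_on carrier G" for \<kappa>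
  proof (rule conservative[OF assms(6,8) _ that(2)])
    have "0 \<le> 1 / (\<delta> * (1 - \<delta>)\<^sup>2)"
      using assms(6) by simp
    then show "1 / \<delta>\<^sup>2 \<le> \<kappa>"
      using that(1) by linarith
  qed
  \<comment> \<open>Here \<open>\<epsilon> = 1/3\<close>, so the bound required of the exponent is \<open>9 \<le> 16\<close>.\<close>
  have part3: "conservative_action G ?M ?T"
    if "\<forall>i\<in>I. 1 / 3 \<le> F i \<and> F i \<le> 2 / 3" "\<not> (\<lambda>g. exp (- 16 * ?D g)) summable_on carrier G"
    by (rule conservative[OF _ _ _ that(2), of "1 / 3"]) (use that(1) in \<open>auto simp: power2_eq_square\<close>)
  have part2: "dissipative_action G ?M ?T"
    if q: "(\<lambda>g. exp (- (1 / 2) * ?D g)) summable_on carrier G"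
  proof -
    \<comment> \<open>If \<open>I\<close> is empty, then every term of the series is \<open>1\<close>. Otherwise \<open>I\<close> contains an orbit,
      on which the infinite group acts simply transitively.\<close>
    have "infinite I"
    proof
      assume "finite I"
      show False
      proof (cases "I = {}")
        case True
        then have "(\<lambda>g. 1 :: real) summable_on carrier G"
          using q by (simp add: ell2_norm_square)
        then show False
          using infsum_diverge_constant[OF assms(3), of "1 :: real"] by simp
      next
        case False
        then obtain i where i: "i \<in> I"
          by blast
        have "inj_on (\<lambda>g. \<phi> g i) (carrier G)"
        proof (rule inj_onI, rule ccontr)
          fix g h assume gh: "g \<in> carrier G" "h \<in> carrier G" "\<phi> g i = \<phi> h i" "g \<noteq> h"
          have "\<phi> (inv\<^bsub>G\<^esub> h \<otimes>\<^bsub>G\<^esub> g) i = \<phi> (inv\<^bsub>G\<^esub> h) (\<phi> h i)"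
            using gh i A.composition_rule[of i "inv\<^bsub>G\<^esub> h" g] by simp
          also have "\<dots> = i"
            by (rule group_action_cancel(1)[OF assms(1) ga gh(2) i])
          finally have "inv\<^bsub>G\<^esub> h \<otimes>\<^bsub>G\<^esub> g = \<one>\<^bsub>G\<^esub>"
            using assms(5) gh i unfolding free_action_def by blast
          then have "h = g"
            using gh by (metis G.inv_closed G.inv_equality G.inv_inv)
          then show False
            using gh(4) by simp
        qed
        moreover have "(\<lambda>g. \<phi> g i) ` carrier G \<subseteq> I"
          using A.element_image[OF _ i refl] by blast
        ultimately have "finite (carrier G)"
          using \<open>finite I\<close> by (meson finite_imageD finite_subset)
        then show False
          using assms(3) by simp
      qed
    qed
    obtain T :: "('i \<Rightarrow> bool) \<Rightarrow> real" where T: "T \<in> borel_measurable ?M" "\<And>x. 0 \<le> T x" "\<And>x. T x < 1"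
      "inj_on T (space ?M)"
      using bernoulli_space_separating_function[OF assms(4) \<open>infinite I\<close>] by blast
    \<comment> \<open>The real-valued version of the density agrees with it almost everywhere, as the measures are
      finite.\<close>
    define w where "w g x = enn2real (RN_deriv ?M (distr ?M ?M (?T g)) x)" for g x
    have w: "w g \<in> borel_measurable ?M" for g
      unfolding w_def by measurable
    have dens: "distr ?M ?M (?T g) = density ?M (w g)" if g: "g \<in> carrier G" for g
    proof -
      have ac: "absolutely_continuous ?M (distr ?M ?M (?T g))"
        by (rule nonsingular_actionD(3)[OF ns g])
      have "finite_measure (distr ?M ?M (?T g))"
        by (rule M.finite_measure_distr[OF nonsingular_actionD(2)[OF ns g]])
      then have "AE x in ?M. RN_deriv ?M (distr ?M ?M (?T g)) x \<noteq> \<infinity>"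
        using ac by (intro M.RN_deriv_finite finite_measure.sigma_finite_measure) auto
      then have "AE x in ?M. RN_deriv ?M (distr ?M ?M (?T g)) x = ennreal (w g x)"
        by eventually_elim (simp add: w_def less_top)
      then have "density ?M (RN_deriv ?M (distr ?M ?M (?T g))) = density ?M (w g)"
        using w by (intro density_cong) auto
      then show ?thesis
        using M.density_RN_deriv[OF ac] by simp
    qed
    show ?thesis
    proof (rule dissipative_action_of_summable_affinities[OF M.prob_space_axioms assms(1) ns assms(2,3) w _ dens])
      show "0 \<le> w g x" for g x
        by (simp add: w_def)
      show "0 \<le> exp (- (1 / 2) * ?D g)" for g
        by simp
      show "(\<integral>\<^sup>+x. ennreal (sqrt (w g x)) \<partial>?M) \<le> ennreal (exp (- (1 / 2) * ?D g))" if g: "g \<in> carrier G" for g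
      proof -
        have "(\<integral>\<^sup>+x. ennreal (sqrt (w g x)) \<partial>?M) \<le> ennreal (exp (- (\<Sum>\<^sub>\<infinity>i\<in>I. (F i - F' g i)\<^sup>2) / 2))"
        proof (rule bernoulli_affinity_le[OF assms(7) _ sum[OF g] w])
          show "F' g i \<in> {0<..<1}" if "i \<in> I" for i
            using assms(7)[OF closed[OF g that]] by (simp add: F'_def)
          show "bernoulli_space I (F' g) = density ?M (w g)"
            using dens[OF g] distr[OF g] by simp
        qed (simp_all add: w_def)
        then show ?thesis
          by (simp add: D)
      qed
      fix g assume g: "g \<in> carrier G" "g \<noteq> \<one>\<^bsub>G\<^esub>"
      have "AE x in ?M. ?T g x \<noteq> x"
        by (rule AE_bernoulli_action_not_fixed[OF assms(1,5) \<open>infinite I\<close> assms(4,6) _ _ g])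
          (use assms(7,8) in auto)
      then show "AE x in ?M. T (?T g x) \<noteq> T x"
      proof (rule AE_mp, intro AE_I2 impI notI)
        fix x assume x: "x \<in> space ?M" "?T g x \<noteq> x" "T (?T g x) = T x"
        show False
          using inj_onD[OF T(4) x(3) measurable_space[OF nonsingular_actionD(2)[OF ns g(1)] x(1)] x(1)] x(2)
          by simp
      qed
    qed (use q T in auto)
  qed
  show ?thesis
    using part1 part2 part3 by blast
qed

end
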